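(* Let $f$ be an operator convex function. The following hold. (i) For strictly positive $\rho$ on a Hilbert space of dimension $d$, $$S_f(\rho)\ \leq\ -\mathrm{Tr}(\rho)\,f\left[\frac{d}{\mathrm{Tr}(\rho)}\right].$$ If $f$ is non-affine, equality holds if and only if $\rho=\mathrm{Tr}(\rho)\,\mathrm{I}/d$. (ii) Let the joint state of the system $AB$ be a pure state $|\phi_{AB}\rangle$, and let $\rho_A=\mathrm{Tr}_B(|\phi_{AB}\rangle\langle\phi_{AB}|)$ and $\rho_B=\mathrm{Tr}_A(|\phi_{AB}\rangle\langle\phi_{AB}|)$ be strictly positive. Then $S_f(\rho_A)=S_f(\rho_B)$. (iii) Projective measurements increase quantum $f$-entropy: for strictly positive $\rho$ and any complete set of orthogonal projectors $\{P_i\}$ with $\sum_i P_i=\mathrm{I}$, $$S_f\left(\sum_i P_i\rho P_i\right)\ \geq\ S_f(\rho).$$ If $f$ is non-affine and diffused, equality holds if and only if the projective measurement leaves the state unchanged, i.e. $\sum_i P_i\rho P_i=\rho$.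
   Context: All Hilbert spaces are finite-dimensional and complex. "Strictly positive" means Hermitian positive definite; no trace normalization is assumed. For Hermitian $A$, $f(A)$ is defined by the spectral decomposition. A real function $f$ on an interval is operator convex if $f[\lambda A+(1-\lambda)B]\leq\lambda f(A)+(1-\lambda)f(B)$ for all Hermitian matrices $A,B$ (of the same, arbitrary size) with spectra in the domain of $f$ and all $0\le\lambda\le1$. Diffused: a non-affine operator convex function $f$ on $(t_0-a,t_0+a)$, $a>0$, is called diffused if it has the representation $$f(t)=b+ct+\kappa\int_{-a}^{a}\frac{(t-t_0)^2}{a^2-(t-t_0)x}\,p_X(x)\,dx$$ with $b,c\in\mathbb{R}$, $\kappa>0$ and $p_X$ a probability density function on $[-a,a]$ that is strictly positive almost everywhere on a (nondegenerate) subinterval of $[-a,a]$ having $x=0$ as an interior or boundary point. Quantum $f$-entropy: for strictly positive $\rho$ with spectral decomposition $\rho=\sum_{i=1}^d p_i|i_\rho\rangle\langle i_\rho|$, $$S_f(\rho)=-\mathrm{Tr}\left[\rho f(\rho^{-1})\right]=-\sum_{i=1}^d p_i f\left(\frac1{p_i}\right).$$ Standing convention: the domain of $f$ is an interval of positive reals (contained in $(0,\alpha)$ for some finite $\alpha$) which contains the spectrum of $\rho^{-1}$ for every $S_f(\rho)$ that occurs.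
   Formalization: "Non-affine" is taken to mean not affine on the interior of the domain of f, since an operator convex f that is affine inside and jumps at an endpoint (1 at t=1, 0 on (1,2]) makes the equality condition in (i) false. *)

theory Defs
  imports
    "HOL-Analysis.Analysis"
    "Jordan_Normal_Form.Gauss_Jordan_Elimination"
    "Jordan_Normal_Form.Schur_Decomposition"
    "Jordan_Normal_Form.Spectral_Radius"
begin

text \<open>Operators on a Hilbert space of dimension \<open>d\<close> are complex \<open>d \<times> d\<close> matrices.\<close>

definition trace_mat :: "complex mat \<Rightarrow> complex" where
  "trace_mat A = (\<Sum>i<dim_row A. A $$ (i, i))"

definition hermitian_mat :: "nat \<Rightarrow> complex mat \<Rightarrow> bool" where
  "hermitian_mat d A \<longleftrightarrow> A \<in> carrier_mat d d \<and> mat_adjoint A = A"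

definition unitary_mat :: "nat \<Rightarrow> complex mat \<Rightarrow> bool" where
  "unitary_mat d U \<longleftrightarrow> U \<in> carrier_mat d d \<and>
     U * mat_adjoint U = 1\<^sub>m d \<and> mat_adjoint U * U = 1\<^sub>m d"

text \<open>For Hermitian \<open>A\<close> the number \<open>(A *\<^sub>v v) \<bullet>c v\<close>, i.e. \<open>\<langle>v|A|v\<rangle>\<close>, is real.\<close>

definition psd_mat :: "nat \<Rightarrow> complex mat \<Rightarrow> bool" where
  "psd_mat d A \<longleftrightarrow> hermitian_mat d A \<and> (\<forall>v \<in> carrier_vec d. 0 \<le> Re ((A *\<^sub>v v) \<bullet>c v))"

definition strictly_positive :: "nat \<Rightarrow> complex mat \<Rightarrow> bool" where
  "strictly_positive d A \<longleftrightarrow> hermitian_mat d A \<and>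
     (\<forall>v \<in> carrier_vec d. v \<noteq> 0\<^sub>v d \<longrightarrow> 0 < Re ((A *\<^sub>v v) \<bullet>c v))"

definition loewner_le :: "nat \<Rightarrow> complex mat \<Rightarrow> complex mat \<Rightarrow> bool" where
  "loewner_le d A B \<longleftrightarrow> A \<in> carrier_mat d d \<and> B \<in> carrier_mat d d \<and> psd_mat d (B - A)"

text \<open>Functional calculus. If \<open>A = U diag(e) U\<^sup>*\<close> with \<open>U\<close> unitary and \<open>e\<close> real, the matrix
  \<open>U diag(f \<circ> e) U\<^sup>*\<close> does not depend on the choice of \<open>U\<close> and \<open>e\<close>; such a decomposition
  exists precisely when \<open>A\<close> is Hermitian.\<close>

definition mat_fun :: "(real \<Rightarrow> real) \<Rightarrow> complex mat \<Rightarrow> complex mat" where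
  "mat_fun f A = (THE B. \<exists>d U e. unitary_mat d U \<and>
     A = U * mat_diag d (\<lambda>i. complex_of_real (e i)) * mat_adjoint U \<and>
     B = U * mat_diag d (\<lambda>i. complex_of_real (f (e i))) * mat_adjoint U)"

definition spectrum_in :: "complex mat \<Rightarrow> real set \<Rightarrow> bool" where
  "spectrum_in A I \<longleftrightarrow> spectrum A \<subseteq> complex_of_real ` I"

definition operator_convex_on :: "real set \<Rightarrow> (real \<Rightarrow> real) \<Rightarrow> bool" where
  "operator_convex_on I f \<longleftrightarrow> is_interval I \<and>
     (\<forall>n A B. \<forall>l::real.
        hermitian_mat n A \<longrightarrow> hermitian_mat n B \<longrightarrow> spectrum_in A I \<longrightarrow> spectrum_in B I \<longrightarrow>
        0 \<le> l \<longrightarrow> l \<le> 1 \<longrightarrow>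
        loewner_le n
          (mat_fun f (complex_of_real l \<cdot>\<^sub>m A + complex_of_real (1 - l) \<cdot>\<^sub>m B))
          (complex_of_real l \<cdot>\<^sub>m mat_fun f A + complex_of_real (1 - l) \<cdot>\<^sub>m mat_fun f B))"

definition affine_fun_on :: "real set \<Rightarrow> (real \<Rightarrow> real) \<Rightarrow> bool" where
  "affine_fun_on I f \<longleftrightarrow> (\<exists>b c. \<forall>t \<in> I. f t = b + c * t)"

text \<open>An operator convex function on an interval that contains an endpoint may jump there: on
  \<open>[1, 2]\<close> the function with value \<open>1\<close> at \<open>1\<close> and \<open>0\<close> elsewhere is operator convex and not
  affine, although it is affine on \<open>(1, 2)\<close>. Such boundary artefacts do not count as
  non-affineness; on open intervals, and for continuous \<open>f\<close> on nondegenerate intervals, this is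
  the usual notion.\<close>

definition non_affine_on :: "real set \<Rightarrow> (real \<Rightarrow> real) \<Rightarrow> bool" where
  "non_affine_on I f \<longleftrightarrow> \<not> affine_fun_on (interior I) f"

definition diffused_on :: "real set \<Rightarrow> (real \<Rightarrow> real) \<Rightarrow> bool" where
  "diffused_on I f \<longleftrightarrow> operator_convex_on I f \<and> non_affine_on I f \<and>
     (\<exists>t0 a b c \<kappa> :: real. \<exists>p :: real \<Rightarrow> real.
        0 < a \<and> I = {t0 - a<..<t0 + a} \<and> 0 < \<kappa> \<and>
        (\<forall>x \<in> {-a..a}. 0 \<le> p x) \<and>
        set_integrable lborel {-a..a} p \<and> (LBINT x:{-a..a}. p x) = 1 \<and>
        (\<exists>u v. -a \<le> u \<and> u < v \<and> v \<le> a \<and> u \<le> 0 \<and> 0 \<le> v \<and>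
           (AE x in lborel. x \<in> {u..v} \<longrightarrow> 0 < p x)) \<and>
        (\<forall>t \<in> I. f t = b + c * t +
           \<kappa> * (LBINT x:{-a..a}. (t - t0)\<^sup>2 / (a\<^sup>2 - (t - t0) * x) * p x)))"

abbreviation mat_inv :: "complex mat \<Rightarrow> complex mat" where
  "mat_inv A \<equiv> the (mat_inverse A)"

definition f_entropy :: "(real \<Rightarrow> real) \<Rightarrow> complex mat \<Rightarrow> real" where
  "f_entropy f \<rho> = - Re (trace_mat (\<rho> * mat_fun f (mat_inv \<rho>)))"

text \<open>The state space of a bipartite system is \<open>\<complex>\<^sup>m \<otimes> \<complex>\<^sup>n = \<complex>\<^sup>m\<^sup>n\<close>, the product basis vector
  with labels \<open>i < m\<close> and \<open>j < n\<close> having index \<open>i * n + j\<close>.\<close>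

definition ket_bra :: "complex vec \<Rightarrow> complex mat" where
  "ket_bra \<phi> = mat (dim_vec \<phi>) (dim_vec \<phi>) (\<lambda>(r, s). vec_index \<phi> r * cnj (vec_index \<phi> s))"

definition partial_trace_B :: "nat \<Rightarrow> nat \<Rightarrow> complex mat \<Rightarrow> complex mat" where
  "partial_trace_B m n M = mat m m (\<lambda>(i, i'). \<Sum>j<n. M $$ (i * n + j, i' * n + j))"

definition partial_trace_A :: "nat \<Rightarrow> nat \<Rightarrow> complex mat \<Rightarrow> complex mat" where
  "partial_trace_A m n M = mat n n (\<lambda>(j, j'). \<Sum>i<m. M $$ (i * n + j, i * n + j'))"

definition mat_sum :: "nat \<Rightarrow> nat \<Rightarrow> (nat \<Rightarrow> complex mat) \<Rightarrow> complex mat" where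
  "mat_sum d k F = mat d d (\<lambda>rs. \<Sum>i<k. F i $$ rs)"

definition complete_projectors :: "nat \<Rightarrow> nat \<Rightarrow> (nat \<Rightarrow> complex mat) \<Rightarrow> bool" where
  "complete_projectors d k P \<longleftrightarrow>
     (\<forall>i<k. hermitian_mat d (P i) \<and> P i * P i = P i) \<and>
     (\<forall>i<k. \<forall>j<k. i \<noteq> j \<longrightarrow> P i * P j = 0\<^sub>m d d) \<and>
     mat_sum d k P = 1\<^sub>m d"

definition measured :: "nat \<Rightarrow> nat \<Rightarrow> (nat \<Rightarrow> complex mat) \<Rightarrow> complex mat \<Rightarrow> complex mat" where
  "measured d k P \<rho> = mat_sum d k (\<lambda>i. P i * \<rho> * P i)"

end

theory Submission
  imports Defs
begin

text \<open>In an eigenbasis \<open>S\<^sub>f(\<rho>) = - \<Sum>\<^sub>i h(p\<^sub>i)\<close> with the perspective \<open>h(p) = p f(1/p)\<close>, which is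
  convex whenever \<open>f\<close> is. Part (i) is Jensen's inequality for \<open>h\<close>; in part (iii) the spectrum of
  the measured state is the image of the spectrum of \<open>\<rho>\<close> under a doubly stochastic matrix, and
  Jensen's inequality applies again; in part (ii) the two reduced states are \<open>N N\<^sup>*\<close> and the
  transpose of \<open>N\<^sup>* N\<close>, which have the same spectrum. The equality cases hold because an operator
  convex function that is affine on some nondegenerate interval is affine throughout the interior
  of its domain, so a non-affine one is strictly convex.\<close>

section \<open>Adjoints, unitary matrices and spectral decompositions\<close>

text \<open>Scalar convexity yields the inequalities, but a function that is merely convex may be
  affine on a subinterval and curved elsewhere, and equality in Jensen then fails to identify the
  state. Excluding this takes the matrix inequality in dimension two. Affineness spreads only to the
  interior because an operator convex function may jump at an endpoint of its domain; strict
  convexity is nevertheless obtained for points anywhere in the domain, endpoints included. Strict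
  Jensen compares numbers, while two matrices with equal spectra may differ. For a measurement the
  doubly stochastic weights are built from overlaps of eigenvectors across a projector, so every
  nonvanishing overlap forces two eigenvalues to agree, and such agreement is the criterion for two
  spectral decompositions to describe one matrix. For a pure state the two subsystems come with
  unrelated dimensions. Strict positivity of both reduced states makes the dimensions equal, so that
  the coefficient matrix of the state is square and invertible.\<close>

lemma mat_adjoint_dim [simp]:
  "dim_row (mat_adjoint A) = dim_col A" "dim_col (mat_adjoint A) = dim_row A"
  unfolding mat_adjoint_def by auto

lemma mat_adjoint_carrier [simp]:
  "A \<in> carrier_mat n m \<Longrightarrow> mat_adjoint A \<in> carrier_mat m n"
  by (intro carrier_matI) auto

lemma mat_adjoint_index [simp]:
  fixes A :: "complex mat"
  assumes "i < dim_col A" "j < dim_row A"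
  shows "mat_adjoint A $$ (i, j) = cnj (A $$ (j, i))"
  using assms unfolding mat_adjoint_def by (simp add: mat_of_rows_index)

lemma mult_mat_index_sum:
  assumes "A \<in> carrier_mat n m" "B \<in> carrier_mat m l" "i < n" "j < l"
  shows "(A * B) $$ (i, j) = (\<Sum>k<m. A $$ (i, k) * B $$ (k, j))"
  using assms by (auto simp: scalar_prod_def lessThan_atLeast0 intro!: sum.cong)

lemma mat_adjoint_adjoint [simp]:
  fixes A :: "complex mat"
  shows "mat_adjoint (mat_adjoint A) = A"
  by (intro eq_matI) auto

lemma mat_adjoint_mult:
  fixes A B :: "complex mat"
  assumes A: "A \<in> carrier_mat n m" and B: "B \<in> carrier_mat m l"
  shows "mat_adjoint (A * B) = mat_adjoint B * mat_adjoint A"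
proof (rule eq_matI)
  fix i j assume "i < dim_row (mat_adjoint B * mat_adjoint A)"
    "j < dim_col (mat_adjoint B * mat_adjoint A)"
  then have i: "i < l" and j: "j < n" using A B by auto
  have "mat_adjoint (A * B) $$ (i, j) = cnj ((A * B) $$ (j, i))"
    using A B i j by (subst mat_adjoint_index) auto
  also have "\<dots> = (\<Sum>k<m. cnj (B $$ (k, i)) * cnj (A $$ (j, k)))"
    using i j by (subst mult_mat_index_sum[OF A B]) (auto simp: mult.commute)
  also have "\<dots> = (mat_adjoint B * mat_adjoint A) $$ (i, j)"
    using A B i j
    by (subst mult_mat_index_sum[of _ l m _ n]) (auto intro!: sum.cong)
  finally show "mat_adjoint (A * B) $$ (i, j) = (mat_adjoint B * mat_adjoint A) $$ (i, j)" .
qed (use A B in auto)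

lemma mat_diag_adjoint [simp]:
  "mat_adjoint (mat_diag d (\<lambda>i. complex_of_real (e i))) = mat_diag d (\<lambda>i. complex_of_real (e i))"
  by (intro eq_matI) (auto simp: mat_diag_def)

lemma unitary_matD:
  assumes "unitary_mat d U"
  shows "U \<in> carrier_mat d d" "U * mat_adjoint U = 1\<^sub>m d" "mat_adjoint U * U = 1\<^sub>m d"
  using assms unfolding unitary_mat_def by auto

lemma unitary_cols:
  assumes "unitary_mat d U" "i < d" "j < d"
  shows "(\<Sum>k<d. cnj (U $$ (k, i)) * U $$ (k, j)) = (if i = j then 1 else 0)"
proof -
  note U = unitary_matD[OF assms(1)]
  have "(mat_adjoint U * U) $$ (i, j) = (\<Sum>k<d. cnj (U $$ (k, i)) * U $$ (k, j))"
    using assms(2-) U(1) by (subst mult_mat_index_sum[of _ d d _ d]) (auto intro!: sum.cong)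
  then show ?thesis using assms(2-) U(3) by auto
qed

lemma unitary_rows:
  assumes "unitary_mat d U" "i < d" "j < d"
  shows "(\<Sum>k<d. U $$ (i, k) * cnj (U $$ (j, k))) = (if i = j then 1 else 0)"
proof -
  note U = unitary_matD[OF assms(1)]
  have "(U * mat_adjoint U) $$ (i, j) = (\<Sum>k<d. U $$ (i, k) * cnj (U $$ (j, k)))"
    using assms(2-) U(1) by (subst mult_mat_index_sum[of _ d d _ d]) (auto intro!: sum.cong)
  then show ?thesis using assms(2-) U(2) by auto
qed

text \<open>For a square matrix a left inverse is also a right inverse, so orthonormal columns are
  all that has to be checked.\<close>

lemma unitary_colsI:
  assumes U: "U \<in> carrier_mat d d"
    and cols: "\<And>i j. i < d \<Longrightarrow> j < d \<Longrightarrow>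
      (\<Sum>k<d. cnj (U $$ (k, i)) * U $$ (k, j)) = (if i = j then 1 else 0)"
  shows "unitary_mat d U"
proof -
  have "mat_adjoint U * U = 1\<^sub>m d"
  proof (rule eq_matI)
    fix i j assume "i < dim_row (1\<^sub>m d :: complex mat)" "j < dim_col (1\<^sub>m d :: complex mat)"
    then have ij: "i < d" "j < d" by auto
    have "(mat_adjoint U * U) $$ (i, j) = (\<Sum>k<d. cnj (U $$ (k, i)) * U $$ (k, j))"
      using ij U by (subst mult_mat_index_sum[of _ d d _ d]) (auto intro!: sum.cong)
    then show "(mat_adjoint U * U) $$ (i, j) = 1\<^sub>m d $$ (i, j)" using cols[OF ij] ij by auto
  qed (use U in auto)
  then show ?thesis
    unfolding unitary_mat_def
    using U mat_mult_left_right_inverse[OF mat_adjoint_carrier[OF U] U] by auto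
qed

lemma unitary_mult:
  assumes U: "unitary_mat d U" and V: "unitary_mat d V"
  shows "unitary_mat d (U * V)"
proof -
  note U' = unitary_matD[OF U] and V' = unitary_matD[OF V]
  note c = U'(1) V'(1) mat_adjoint_carrier[OF U'(1)] mat_adjoint_carrier[OF V'(1)]
  have adj: "mat_adjoint (U * V) = mat_adjoint V * mat_adjoint U"
    by (rule mat_adjoint_mult[OF c(1,2)])
  have "mat_adjoint (U * V) * (U * V) = mat_adjoint V * (mat_adjoint U * U) * V"
    unfolding adj using c by (simp add: assoc_mult_mat[of _ d d _ d _ d] mult_carrier_mat[of _ d d _ d]
        right_mult_one_mat[of _ d d] left_mult_one_mat[of _ d d])
  also have "\<dots> = 1\<^sub>m d" using c V' U' by simp
  finally have 1: "mat_adjoint (U * V) * (U * V) = 1\<^sub>m d" .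
  have UV: "U * V \<in> carrier_mat d d" using c by auto
  from 1 show ?thesis
    unfolding unitary_mat_def
    using UV mat_mult_left_right_inverse[OF mat_adjoint_carrier[OF UV] UV] by auto
qed

text \<open>\<open>U\<close> is deliberately not bound to be unitary or square: with
  \<open>P l * V\<close> in its place the same expression is \<open>P l * \<rho> * P l\<close> for a
  Hermitian projector, and the diagonal is still a sum of the \<open>e i\<close> weighted by squared
  moduli.\<close>

definition spectral_mat :: "nat \<Rightarrow> complex mat \<Rightarrow> (nat \<Rightarrow> real) \<Rightarrow> complex mat" where
  "spectral_mat d U e = U * mat_diag d (\<lambda>i. complex_of_real (e i)) * mat_adjoint U"

lemma spectral_mat_carrier [simp]:
  "U \<in> carrier_mat n d \<Longrightarrow> spectral_mat d U e \<in> carrier_mat n n"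
  unfolding spectral_mat_def by auto

lemma spectral_mat_dim [simp]:
  "dim_row (spectral_mat d U e) = dim_row U" "dim_col (spectral_mat d U e) = dim_row U"
  unfolding spectral_mat_def by auto

lemma spectral_mat_index:
  assumes U: "U \<in> carrier_mat n d" and "r < n" "s < n"
  shows "spectral_mat d U e $$ (r, s) =
    (\<Sum>i<d. complex_of_real (e i) * (U $$ (r, i) * cnj (U $$ (s, i))))"
  using assms unfolding spectral_mat_def mat_diag_mult_right[OF U]
  by (subst mult_mat_index_sum[of _ n d _ n]) (auto intro!: sum.cong)

lemma spectral_mat_diag_index:
  assumes "U \<in> carrier_mat n d" "r < n"
  shows "spectral_mat d U e $$ (r, r) = complex_of_real (\<Sum>i<d. e i * (cmod (U $$ (r, i)))\<^sup>2)"
  using assms by (simp add: spectral_mat_index complex_norm_square del: of_real_power)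

lemma spectral_mat_hermitian:
  assumes U: "U \<in> carrier_mat n d"
  shows "hermitian_mat n (spectral_mat d U e)"
proof -
  let ?D = "mat_diag d (\<lambda>i. complex_of_real (e i))"
  have UD: "U * ?D \<in> carrier_mat n d" using U mat_diag_dim by (rule mult_carrier_mat)
  have "mat_adjoint (spectral_mat d U e) = U * (?D * mat_adjoint U)"
    unfolding spectral_mat_def mat_adjoint_mult[OF UD mat_adjoint_carrier[OF U]]
      mat_adjoint_mult[OF U mat_diag_dim] by simp
  also have "\<dots> = spectral_mat d U e"
    unfolding spectral_mat_def
    by (rule assoc_mult_mat[OF U mat_diag_dim mat_adjoint_carrier[OF U], symmetric])
  finally have "mat_adjoint (spectral_mat d U e) = spectral_mat d U e" .
  then show ?thesis using U unfolding hermitian_mat_def by auto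
qed

lemma spectral_mat_mult_unitary:
  assumes "unitary_mat d U"
  shows "spectral_mat d U e * U = U * mat_diag d (\<lambda>i. complex_of_real (e i))"
proof -
  note U = unitary_matD[OF assms]
  show ?thesis
    unfolding spectral_mat_def using U
    by (simp add: assoc_mult_mat[of _ d d _ d _ d] mult_carrier_mat[of _ d d _ d]
        right_mult_one_mat[of _ d d] left_mult_one_mat[of _ d d])
qed

lemma spectral_mat_eigen:
  assumes U: "unitary_mat d U" and "r < d" "i < d"
  shows "(\<Sum>s<d. spectral_mat d U e $$ (r, s) * U $$ (s, i)) = complex_of_real (e i) * U $$ (r, i)"
proof -
  note U = unitary_matD[OF U]
  have "(\<Sum>s<d. spectral_mat d U e $$ (r, s) * U $$ (s, i)) = (spectral_mat d U e * U) $$ (r, i)"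
    using assms U by (subst mult_mat_index_sum[of _ d d _ d]) auto
  also have "\<dots> = complex_of_real (e i) * U $$ (r, i)"
    unfolding spectral_mat_mult_unitary[OF assms(1)] mat_diag_mult_right[OF U(1)]
    using assms by simp
  finally show ?thesis .
qed

lemma spectral_mat_conj:
  assumes U: "unitary_mat d U"
  shows "mat_adjoint U * spectral_mat d U e * U = mat_diag d (\<lambda>i. complex_of_real (e i))"
proof -
  note U = unitary_matD[OF U]
  have "mat_adjoint U * spectral_mat d U e * U = mat_adjoint U * (spectral_mat d U e * U)"
    using U by (simp add: assoc_mult_mat[of _ d d _ d _ d] mult_carrier_mat[of _ d d _ d]
        right_mult_one_mat[of _ d d] left_mult_one_mat[of _ d d])
  also have "\<dots> = (mat_adjoint U * U) * mat_diag d (\<lambda>i. complex_of_real (e i))"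
    unfolding spectral_mat_mult_unitary[OF assms] using U(1)
    by (subst assoc_mult_mat[of _ d d _ d _ d]) auto
  also have "\<dots> = mat_diag d (\<lambda>i. complex_of_real (e i))"
    unfolding U(3) by (rule left_mult_one_mat[OF mat_diag_dim])
  finally show ?thesis .
qed

text \<open>Conjugating back by the common \<open>U\<close> recovers both diagonals, in the same
  order.\<close>

lemma spectral_mat_inj:
  assumes U: "unitary_mat d U" and eq: "spectral_mat d U e = spectral_mat d U e'" and "i < d"
  shows "e i = e' i"
proof -
  have "mat_diag d (\<lambda>i. complex_of_real (e i)) = mat_diag d (\<lambda>i. complex_of_real (e' i))"
    using spectral_mat_conj[OF U, of e] spectral_mat_conj[OF U, of e'] eq by simp
  then have "mat_diag d (\<lambda>i. complex_of_real (e i)) $$ (i, i) =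
      mat_diag d (\<lambda>i. complex_of_real (e' i)) $$ (i, i)" by simp
  then show ?thesis using \<open>i < d\<close> by (simp add: mat_diag_def)
qed

lemma spectral_mat_const:
  assumes U: "unitary_mat d U"
  shows "spectral_mat d U (\<lambda>_. c) = complex_of_real c \<cdot>\<^sub>m 1\<^sub>m d"
proof (rule eq_matI)
  note U' = unitary_matD[OF U]
  fix r s assume "r < dim_row (complex_of_real c \<cdot>\<^sub>m 1\<^sub>m d)" "s < dim_col (complex_of_real c \<cdot>\<^sub>m 1\<^sub>m d)"
  then have rs: "r < d" "s < d" by auto
  show "spectral_mat d U (\<lambda>_. c) $$ (r, s) = (complex_of_real c \<cdot>\<^sub>m 1\<^sub>m d) $$ (r, s)"
    using rs by (simp add: spectral_mat_index[OF U'(1)] sum_distrib_left[symmetric] unitary_rows[OF U])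
qed (use unitary_matD[OF U] in auto)

lemma spectral_mat_mult:
  assumes U: "unitary_mat d U"
  shows "spectral_mat d U e * spectral_mat d U e' = spectral_mat d U (\<lambda>i. e i * e' i)"
proof -
  note U' = unitary_matD[OF U]
  have "spectral_mat d U e * spectral_mat d U e' =
    U * mat_diag d (\<lambda>i. complex_of_real (e i)) * (mat_adjoint U * U) *
      mat_diag d (\<lambda>i. complex_of_real (e' i)) * mat_adjoint U"
    unfolding spectral_mat_def using U'(1)
    by (simp add: assoc_mult_mat[of _ d d _ d _ d] mult_carrier_mat[of _ d d _ d]
        right_mult_one_mat[of _ d d] left_mult_one_mat[of _ d d])
  also have "\<dots> = U * (mat_diag d (\<lambda>i. complex_of_real (e i)) *
      mat_diag d (\<lambda>i. complex_of_real (e' i))) * mat_adjoint U"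
    unfolding U'(3) using U'(1)
    by (simp add: assoc_mult_mat[of _ d d _ d _ d] mult_carrier_mat[of _ d d _ d]
        right_mult_one_mat[of _ d d] left_mult_one_mat[of _ d d] del: mat_diag_diag)
  finally show ?thesis unfolding spectral_mat_def by simp
qed

lemma trace_spectral_mat:
  assumes U: "unitary_mat d U"
  shows "trace_mat (spectral_mat d U e) = complex_of_real (\<Sum>i<d. e i)"
proof -
  note U' = unitary_matD[OF U]
  have "trace_mat (spectral_mat d U e) =
      (\<Sum>r<d. \<Sum>i<d. complex_of_real (e i) * (cnj (U $$ (r, i)) * U $$ (r, i)))"
    unfolding trace_mat_def using U'(1)
    by (auto simp: spectral_mat_index carrier_matD[OF spectral_mat_carrier[OF U'(1)]] mult_ac
        intro!: sum.cong)
  also have "\<dots> = (\<Sum>i<d. complex_of_real (e i) * (\<Sum>r<d. cnj (U $$ (r, i)) * U $$ (r, i)))"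
    by (subst sum.swap) (simp add: sum_distrib_left)
  also have "\<dots> = (\<Sum>i<d. complex_of_real (e i))"
    by (simp add: unitary_cols[OF U])
  finally show ?thesis by simp
qed

text \<open>Two decompositions of one matrix are intertwined by the overlap matrix \<open>W = V\<^sup>* U\<close>, and
  \<open>W i j \<noteq> 0\<close> forces the eigenvalues \<open>e' i\<close> and \<open>e j\<close> to agree.\<close>

lemma spectral_mat_eq_iff_intertwine:
  assumes U: "unitary_mat d U" and V: "unitary_mat d V"
  shows "spectral_mat d U e = spectral_mat d V e' \<longleftrightarrow>
    (\<forall>i<d. \<forall>j<d. (mat_adjoint V * U) $$ (i, j) * complex_of_real (e j) =
      complex_of_real (e' i) * (mat_adjoint V * U) $$ (i, j))"
proof -
  note U' = unitary_matD[OF U] and V' = unitary_matD[OF V]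
  note c = U'(1) V'(1) mat_adjoint_carrier[OF U'(1)] mat_adjoint_carrier[OF V'(1)]
  let ?D = "mat_diag d (\<lambda>i. complex_of_real (e i))"
  let ?D' = "mat_diag d (\<lambda>i. complex_of_real (e' i))"
  define W where "W = mat_adjoint V * U"
  have W: "W \<in> carrier_mat d d" using c unfolding W_def by auto
  have "spectral_mat d U e = spectral_mat d V e' \<longleftrightarrow> W * ?D = ?D' * W"
  proof
    assume "spectral_mat d U e = spectral_mat d V e'"
    then have "mat_adjoint V * (spectral_mat d U e * U) =
        mat_adjoint V * (spectral_mat d V e' * (V * mat_adjoint V) * U)"
      using V' c by (simp add: right_mult_one_mat[of _ d d])
    also have "\<dots> = mat_adjoint V * spectral_mat d V e' * V * (mat_adjoint V * U)"
      using c by (simp add: assoc_mult_mat[of _ d d _ d _ d] mult_carrier_mat[of _ d d _ d])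
    also have "\<dots> = ?D' * W"
      unfolding W_def spectral_mat_conj[OF V] ..
    finally show "W * ?D = ?D' * W"
      unfolding spectral_mat_mult_unitary[OF U] W_def using c by (simp add: assoc_mult_mat[of _ d d _ d _ d] mult_carrier_mat[of _ d d _ d])
  next
    assume *: "W * ?D = ?D' * W"
    have "spectral_mat d U e = (V * mat_adjoint V) * U * ?D * mat_adjoint U"
      unfolding spectral_mat_def V'(2) using c by simp
    also have "\<dots> = V * (W * ?D) * mat_adjoint U"
      unfolding W_def using c by (simp add: assoc_mult_mat[of _ d d _ d _ d] mult_carrier_mat[of _ d d _ d])
    also have "\<dots> = V * ?D' * mat_adjoint V * (U * mat_adjoint U)"
      unfolding * unfolding W_def using c by (simp add: assoc_mult_mat[of _ d d _ d _ d] mult_carrier_mat[of _ d d _ d])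
    also have "\<dots> = spectral_mat d V e'"
      unfolding spectral_mat_def U'(2) using c by simp
    finally show "spectral_mat d U e = spectral_mat d V e'" .
  qed
  also have "\<dots> \<longleftrightarrow> (\<forall>i<d. \<forall>j<d. W $$ (i, j) * complex_of_real (e j) = complex_of_real (e' i) * W $$ (i, j))"
    unfolding mat_diag_mult_right[OF W] mat_diag_mult_left[OF W] by (auto simp: mat_eq_iff)
  finally show ?thesis unfolding W_def .
qed

text \<open>Where the overlap is nonzero the two eigenvalues coincide, hence so do their images
  under \<open>f\<close>; where it is zero nothing is claimed. The intertwining relation thus
  survives \<open>f\<close>, which makes the functional calculus well defined.\<close>

lemma spectral_mat_fun_unique:
  assumes U: "unitary_mat d U" and V: "unitary_mat d V"
    and eq: "spectral_mat d U e = spectral_mat d V e'"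
  shows "spectral_mat d U (\<lambda>i. f (e i)) = spectral_mat d V (\<lambda>i. f (e' i))"
  unfolding spectral_mat_eq_iff_intertwine[OF U V]
proof (intro allI impI)
  fix i j assume "i < d" "j < d"
  then have "(mat_adjoint V * U) $$ (i, j) * complex_of_real (e j) =
      complex_of_real (e' i) * (mat_adjoint V * U) $$ (i, j)"
    using eq[unfolded spectral_mat_eq_iff_intertwine[OF U V]] by blast
  then show "(mat_adjoint V * U) $$ (i, j) * complex_of_real (f (e j)) =
      complex_of_real (f (e' i)) * (mat_adjoint V * U) $$ (i, j)"
    by (cases "(mat_adjoint V * U) $$ (i, j) = 0") (auto simp del: index_mult_mat)
qed

lemma mat_fun_spectral_mat:
  assumes U: "unitary_mat d U"
  shows "mat_fun f (spectral_mat d U e) = spectral_mat d U (\<lambda>i. f (e i))"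
  unfolding mat_fun_def spectral_mat_def[symmetric]
proof (rule the_equality)
  show "\<exists>d' V e'. unitary_mat d' V \<and> spectral_mat d U e = spectral_mat d' V e' \<and>
      spectral_mat d U (\<lambda>i. f (e i)) = spectral_mat d' V (\<lambda>i. f (e' i))"
    using U by blast
next
  fix B
  assume "\<exists>d' V e'. unitary_mat d' V \<and> spectral_mat d U e = spectral_mat d' V e' \<and>
      B = spectral_mat d' V (\<lambda>i. f (e' i))"
  then obtain d' V e' where V: "unitary_mat d' V" and eq: "spectral_mat d U e = spectral_mat d' V e'"
    and B: "B = spectral_mat d' V (\<lambda>i. f (e' i))" by blast
  \<comment> \<open>The description in \<open>mat_fun\<close> quantifies over the dimension too, so
    it is first read off the size of the matrix.\<close>
  have "d' = d"
    using carrier_matD(1)[OF spectral_mat_carrier[OF unitary_matD(1)[OF U]], of e]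
      carrier_matD(1)[OF spectral_mat_carrier[OF unitary_matD(1)[OF V]], of e'] eq by simp
  with V eq B show "B = spectral_mat d U (\<lambda>i. f (e i))"
    using spectral_mat_fun_unique[OF U, of V e e' f] by simp
qed

lemma spectrum_spectral_mat:
  assumes U: "unitary_mat d U"
  shows "spectrum (spectral_mat d U e) = (\<lambda>i. complex_of_real (e i)) ` {..<d}"
proof -
  note U' = unitary_matD[OF U]
  let ?D = "mat_diag d (\<lambda>i. complex_of_real (e i))"
  have D: "?D \<in> carrier_mat d d" by simp
  have "similar_mat_wit (spectral_mat d U e) ?D U (mat_adjoint U)"
    by (rule similar_mat_witI[of _ _ d]) (use U' D in \<open>auto simp: spectral_mat_def\<close>)
  then have "similar_mat (spectral_mat d U e) ?D" unfolding similar_mat_def by blast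
  then have "char_poly (spectral_mat d U e) = char_poly ?D" by (rule char_poly_similar)
  also have "\<dots> = (\<Prod>a\<leftarrow>diag_mat ?D. [:- a, 1:])"
    by (rule char_poly_upper_triangular[OF D]) (auto simp: mat_diag_def)
  finally show ?thesis
    unfolding spectrum_root_char_poly[OF spectral_mat_carrier[OF U'(1)]]
    by (auto simp: poly_prod_list prod_list_zero_iff diag_mat_def mat_diag_def)
qed

lemma spectrum_in_spectral_mat:
  assumes U: "unitary_mat d U"
  shows "spectrum_in (spectral_mat d U e) I \<longleftrightarrow> (\<forall>i<d. e i \<in> I)"
  unfolding spectrum_in_def spectrum_spectral_mat[OF U] by auto

section \<open>The spectral theorem and the entropy in an eigenbasis\<close>

text \<open>Gram-Schmidt applied to a basis that starts with \<open>v\<close> keeps \<open>v\<close>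
  as its first vector, so normalising changes the first column only by a factor.\<close>

lemma unitary_with_first_col:
  fixes v :: "complex vec"
  assumes v: "v \<in> carrier_vec n" and v0: "v \<noteq> 0\<^sub>v n"
  shows "\<exists>U c. unitary_mat n U \<and> (\<forall>i<n. U $$ (i, 0) = c * vec_index v i)"
proof -
  have n: "n \<noteq> 0" using v v0 by (metis carrier_vecD eq_vecI index_zero_vec(2) not_less_zero)
  define b where "b = basis_completion v"
  define ws where "ws = gram_schmidt n b"
  interpret cof_vec_space n "TYPE(complex)" .
  from basis_completion[OF v v0, folded b_def]
  have dist_b: "distinct b" and indep: "\<not> lin_dep (set b)" and b: "set b \<subseteq> carrier_vec n"
    and hdb: "hd b = v" and len_b: "length b = n" by auto
  from hdb len_b n obtain vs where bv: "b = v # vs" by (cases b) auto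
  from gram_schmidt_result[OF b dist_b indep refl, folded ws_def]
  have ws: "set ws \<subseteq> carrier_vec n" "corthogonal ws" "length ws = n"
    by (auto simp: len_b)
  from gram_schmidt_hd[OF v, of vs, folded bv] have hdws: "hd ws = v" unfolding ws_def .
  have ws0: "ws ! 0 = v" using hdws ws(3) n by (cases ws) auto
  have wsc: "ws ! j \<in> carrier_vec n" if "j < n" for j using ws that by auto
  have ip: "(\<Sum>k<n. cnj (vec_index (ws ! i) k) * vec_index (ws ! j) k) = ws ! j \<bullet>c ws ! i"
    if "i < n" "j < n" for i j
    using wsc[OF that(1)] wsc[OF that(2)]
    by (auto simp: scalar_prod_def lessThan_atLeast0 mult.commute intro!: sum.cong)
  \<comment> \<open>The norms are embedded reals, so conjugation fixes them and the inner product of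
    two columns of \<open>U\<close> is divided by their plain product.\<close>
  define N where "N j = complex_of_real (sqrt (\<Sum>k<n. (cmod (vec_index (ws ! j) k))\<^sup>2))" for j
  have N2: "ws ! j \<bullet>c ws ! j = N j * N j" if "j < n" for j
  proof -
    have "ws ! j \<bullet>c ws ! j = (\<Sum>k<n. cnj (vec_index (ws ! j) k) * vec_index (ws ! j) k)"
      using ip[OF that that] by simp
    also have "\<dots> = complex_of_real (\<Sum>k<n. (cmod (vec_index (ws ! j) k))\<^sup>2)"
      by (simp add: complex_norm_square mult.commute del: of_real_power)
    also have "\<dots> = N j * N j"
      unfolding N_def of_real_mult[symmetric] by (simp add: sum_nonneg)
    finally show ?thesis .
  qed
  have N0: "N j \<noteq> 0" if "j < n" for j
    using corthogonalD[OF ws(2), of j j] that ws(3) N2[OF that] by auto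
  define U where "U = mat n n (\<lambda>(i, j). vec_index (ws ! j) i / N j)"
  have U: "U \<in> carrier_mat n n" unfolding U_def by auto
  have "unitary_mat n U"
  proof (rule unitary_colsI[OF U])
    fix i j assume ij: "i < n" "j < n"
    have "(\<Sum>k<n. cnj (U $$ (k, i)) * U $$ (k, j)) =
        (\<Sum>k<n. cnj (vec_index (ws ! i) k) * vec_index (ws ! j) k) / (N i * N j)"
      using ij unfolding U_def sum_divide_distrib by (auto simp: N_def intro!: sum.cong)
    also have "\<dots> = (ws ! j \<bullet>c ws ! i) / (N i * N j)" using ip[OF ij] by simp
    also have "\<dots> = (if i = j then 1 else 0)"
      using corthogonalD[OF ws(2), of j i] ij ws(3) N2[of i] N0[of i] by auto
    finally show "(\<Sum>k<n. cnj (U $$ (k, i)) * U $$ (k, j)) = (if i = j then 1 else 0)" .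
  qed
  moreover have "\<forall>i<n. U $$ (i, 0) = (1 / N 0) * vec_index v i"
    using n ws0 unfolding U_def by auto
  ultimately show ?thesis by blast
qed

section \<open>Hermitian matrices under congruence and diagonalisation\<close>

lemma hermitian_mat_index:
  assumes "hermitian_mat d A" "i < d" "j < d"
  shows "cnj (A $$ (i, j)) = A $$ (j, i)"
proof -
  have A: "A \<in> carrier_mat d d" and adj: "mat_adjoint A = A"
    using assms(1) unfolding hermitian_mat_def by auto
  have "mat_adjoint A $$ (j, i) = cnj (A $$ (i, j))" using A assms(2-) by simp
  then show ?thesis unfolding adj by simp
qed

lemma hermitian_matI:
  assumes "A \<in> carrier_mat d d" "\<And>i j. i < d \<Longrightarrow> j < d \<Longrightarrow> cnj (A $$ (i, j)) = A $$ (j, i)"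
  shows "hermitian_mat d A"
  using assms unfolding hermitian_mat_def by (auto intro!: eq_matI)

lemma hermitian_congruence:
  assumes A: "hermitian_mat n A" and U: "U \<in> carrier_mat n m"
  shows "hermitian_mat m (mat_adjoint U * A * U)"
proof -
  have Ac: "A \<in> carrier_mat n n" and adj: "mat_adjoint A = A"
    using A unfolding hermitian_mat_def by auto
  note U' = mat_adjoint_carrier[OF U]
  have "mat_adjoint (mat_adjoint U * A * U) = mat_adjoint U * (A * U)"
    unfolding mat_adjoint_mult[OF mult_carrier_mat[OF U' Ac] U] mat_adjoint_mult[OF U' Ac] adj
    by simp
  also have "\<dots> = mat_adjoint U * A * U"
    by (rule assoc_mult_mat[OF U' Ac U, symmetric])
  finally show ?thesis
    unfolding hermitian_mat_def using mult_carrier_mat[OF mult_carrier_mat[OF U' Ac] U] by blast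
qed

lemma spectral_mat_conjugate:
  assumes U: "U \<in> carrier_mat n m" and V: "V \<in> carrier_mat m k"
  shows "U * spectral_mat k V e * mat_adjoint U = spectral_mat k (U * V) e"
proof -
  let ?D = "mat_diag k (\<lambda>i. complex_of_real (e i))"
  note U' = mat_adjoint_carrier[OF U] and V' = mat_adjoint_carrier[OF V]
  have VD: "V * ?D \<in> carrier_mat m k" using V mat_diag_dim by (rule mult_carrier_mat)
  have UV: "U * V \<in> carrier_mat n k" using U V by (rule mult_carrier_mat)
  have UVD: "U * V * ?D \<in> carrier_mat n k" using UV mat_diag_dim by (rule mult_carrier_mat)
  have "U * (V * ?D * mat_adjoint V) = U * (V * ?D) * mat_adjoint V"
    by (rule assoc_mult_mat[OF U VD V', symmetric])
  also have "U * (V * ?D) = U * V * ?D"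
    by (rule assoc_mult_mat[OF U V mat_diag_dim, symmetric])
  finally have "U * (V * ?D * mat_adjoint V) = U * V * ?D * mat_adjoint V" .
  then show ?thesis
    unfolding spectral_mat_def mat_adjoint_mult[OF U V]
    using assoc_mult_mat[OF UVD V' U'] by simp
qed

text \<open>Deflation: in an orthonormal basis starting with an eigenvector, the first row and column of
  \<open>A\<close> vanish off the diagonal.\<close>

theorem hermitian_spectral_decomposition:
  assumes "hermitian_mat d A"
  shows "\<exists>U e. unitary_mat d U \<and> A = spectral_mat d U e"
  using assms
proof (induction d arbitrary: A)
  case 0
  then have A: "A \<in> carrier_mat 0 0" unfolding hermitian_mat_def by auto
  have "unitary_mat 0 (1\<^sub>m 0)" unfolding unitary_mat_def by (auto intro!: eq_matI)
  moreover have "A = spectral_mat 0 (1\<^sub>m 0) (\<lambda>_. 0)" using A by (intro eq_matI) auto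
  ultimately show ?case by blast
next
  case (Suc m)
  let ?n = "Suc m"
  have A: "A \<in> carrier_mat ?n ?n" using Suc.prems unfolding hermitian_mat_def by auto
  obtain ev where "eigenvalue A ev" using spectrum_non_empty[OF A] unfolding spectrum_def by auto
  then obtain v where v: "v \<in> carrier_vec ?n" "v \<noteq> 0\<^sub>v ?n" and Av: "A *\<^sub>v v = ev \<cdot>\<^sub>v v"
    unfolding eigenvalue_def eigenvector_def using A by auto
  obtain U c where U: "unitary_mat ?n U" and Uv: "\<forall>i<?n. U $$ (i, 0) = c * vec_index v i"
    using unitary_with_first_col[OF v] by blast
  note U' = unitary_matD[OF U]
  note Ua = mat_adjoint_carrier[OF U'(1)]
  define B where "B = mat_adjoint U * A * U"
  have hB: "hermitian_mat ?n B" unfolding B_def by (rule hermitian_congruence[OF Suc.prems U'(1)])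
  have B: "B \<in> carrier_mat ?n ?n" using hB unfolding hermitian_mat_def by auto
  have AU0: "(A * U) $$ (i, 0) = ev * U $$ (i, 0)" if i: "i < ?n" for i
  proof -
    have "(A * U) $$ (i, 0) = (\<Sum>k<?n. A $$ (i, k) * U $$ (k, 0))"
      by (rule mult_mat_index_sum[OF A U'(1) i]) simp
    also have "\<dots> = c * (\<Sum>k<?n. A $$ (i, k) * vec_index v k)"
      unfolding sum_distrib_left using Uv by (intro sum.cong) auto
    also have "(\<Sum>k<?n. A $$ (i, k) * vec_index v k) = vec_index (A *\<^sub>v v) i"
      using A v i by (auto simp: scalar_prod_def lessThan_atLeast0 intro!: sum.cong)
    also have "\<dots> = ev * vec_index v i" unfolding Av using v i by simp
    finally show ?thesis using Uv i by simp
  qed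
  have B0: "B $$ (i, 0) = (if i = 0 then ev else 0)" if i: "i < ?n" for i
  proof -
    have "B = mat_adjoint U * (A * U)"
      unfolding B_def by (rule assoc_mult_mat[OF Ua A U'(1)])
    then have "B $$ (i, 0) = (\<Sum>k<?n. mat_adjoint U $$ (i, k) * (A * U) $$ (k, 0))"
      using mult_mat_index_sum[OF Ua mult_carrier_mat[OF A U'(1)] i, of 0] by simp
    also have "\<dots> = (\<Sum>k<?n. ev * (cnj (U $$ (k, i)) * U $$ (k, 0)))"
      using U'(1) i by (intro sum.cong) (auto simp del: index_mult_mat simp: AU0)
    also have "\<dots> = ev * (\<Sum>k<?n. cnj (U $$ (k, i)) * U $$ (k, 0))"
      by (rule sum_distrib_left[symmetric])
    also have "\<dots> = (if i = 0 then ev else 0)"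
      by (subst unitary_cols[OF U i]) auto
    finally show ?thesis .
  qed
  have B0': "B $$ (0, j) = (if j = 0 then ev else 0)" if j: "j < ?n" for j
  proof (cases "j = 0")
    case False
    then show ?thesis using hermitian_mat_index[OF hB j, of 0] B0[OF j] by simp
  qed (simp add: B0)
  \<comment> \<open>The eigenvalue sits in a diagonal entry of a Hermitian matrix, which equals its
    own conjugate.\<close>
  have ev: "ev = complex_of_real (Re ev)"
    using hermitian_mat_index[OF hB, of 0 0] B0[of 0] by (simp add: complex_eq_iff)
  define A' where "A' = mat m m (\<lambda>(i, j). B $$ (Suc i, Suc j))"
  have "hermitian_mat m A'"
    by (rule hermitian_matI) (auto simp: A'_def hermitian_mat_index[OF hB])
  from Suc.IH[OF this] obtain V e where V: "unitary_mat m V" and A'V: "A' = spectral_mat m V e"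
    by blast
  note V' = unitary_matD[OF V]
  \<comment> \<open>\<open>W\<close> is the direct sum of \<open>1\<close> and the eigenbasis
    \<open>V\<close> of the smaller block; \<open>e'\<close> prepends the eigenvalue that was split
    off.\<close>
  define W where "W = mat ?n ?n (\<lambda>(i, j). case i of 0 \<Rightarrow> (if j = 0 then 1 else 0)
     | Suc i' \<Rightarrow> (case j of 0 \<Rightarrow> 0 | Suc j' \<Rightarrow> V $$ (i', j')))"
  define e' where "e' i = (case i of 0 \<Rightarrow> Re ev | Suc i' \<Rightarrow> e i')" for i
  have W: "W \<in> carrier_mat ?n ?n" unfolding W_def by auto
  have W00: "W $$ (0, 0) = 1" and W0: "j < m \<Longrightarrow> W $$ (0, Suc j) = 0"
    and Wj: "i < m \<Longrightarrow> W $$ (Suc i, 0) = 0"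
    and WS: "i < m \<Longrightarrow> j < m \<Longrightarrow> W $$ (Suc i, Suc j) = V $$ (i, j)" for i j
    unfolding W_def by auto
  have uW: "unitary_mat ?n W"
  proof (rule unitary_colsI[OF W])
    fix i j assume ij: "i < ?n" "j < ?n"
    show "(\<Sum>k<?n. cnj (W $$ (k, i)) * W $$ (k, j)) = (if i = j then 1 else 0)"
      unfolding sum.lessThan_Suc_shift using ij
      by (cases i; cases j) (auto simp: W00 W0 Wj WS unitary_cols[OF V])
  qed
  have BW: "B = spectral_mat ?n W e'"
  proof (rule eq_matI)
    fix r s assume "r < dim_row (spectral_mat ?n W e')" "s < dim_col (spectral_mat ?n W e')"
    then have rs: "r < ?n" "s < ?n" using W by auto
    have BS: "B $$ (Suc r', Suc s') = (\<Sum>i<m. complex_of_real (e i) * (V $$ (r', i) * cnj (V $$ (s', i))))"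
      if "r' < m" "s' < m" for r' s'
    proof -
      have "B $$ (Suc r', Suc s') = A' $$ (r', s')" using that unfolding A'_def by simp
      then show ?thesis unfolding A'V spectral_mat_index[OF V'(1) that] .
    qed
    show "B $$ (r, s) = spectral_mat ?n W e' $$ (r, s)"
      unfolding spectral_mat_index[OF W rs] sum.lessThan_Suc_shift using rs ev
      by (cases r; cases s) (auto simp: W00 W0 Wj WS e'_def B0 B0' BS)
  qed (use B W in auto)
  have "A = (U * mat_adjoint U) * A * (U * mat_adjoint U)"
    unfolding U'(2) using A by simp
  also have "\<dots> = U * B * mat_adjoint U"
    unfolding B_def using A U'(1) Ua
    by (simp add: assoc_mult_mat[of _ ?n ?n _ ?n _ ?n] mult_carrier_mat[of _ ?n ?n _ ?n])
  also have "\<dots> = spectral_mat ?n (U * W) e'"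
    unfolding BW by (rule spectral_mat_conjugate[OF U'(1) W])
  finally show ?case using unitary_mult[OF U uW] by blast
qed

section \<open>Positive eigenvalues, inverses and the entropy as a sum over eigenvalues\<close>

lemma quadratic_form_index:
  assumes A: "A \<in> carrier_mat d d" and v: "v \<in> carrier_vec d"
  shows "(A *\<^sub>v v) \<bullet>c v = (\<Sum>r<d. (\<Sum>s<d. A $$ (r, s) * vec_index v s) * cnj (vec_index v r))"
  using assms by (auto simp: scalar_prod_def lessThan_atLeast0 intro!: sum.cong)

lemma quadratic_form_col:
  assumes U: "unitary_mat d U" and i: "i < d"
  shows "(spectral_mat d U e *\<^sub>v col U i) \<bullet>c col U i = complex_of_real (e i)"
proof -
  note U' = unitary_matD[OF U]
  have c: "col U i \<in> carrier_vec d" using U'(1) i by auto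
  have "(spectral_mat d U e *\<^sub>v col U i) \<bullet>c col U i =
     (\<Sum>r<d. (\<Sum>s<d. spectral_mat d U e $$ (r, s) * U $$ (s, i)) * cnj (U $$ (r, i)))"
    unfolding quadratic_form_index[OF spectral_mat_carrier[OF U'(1)] c]
    using U'(1) i by (auto intro!: sum.cong)
  also have "\<dots> = (\<Sum>r<d. complex_of_real (e i) * (cnj (U $$ (r, i)) * U $$ (r, i)))"
    by (intro sum.cong refl) (simp add: spectral_mat_eigen[OF U _ i])
  also have "\<dots> = complex_of_real (e i)"
    unfolding sum_distrib_left[symmetric] by (simp add: unitary_cols[OF U i i])
  finally show ?thesis .
qed

text \<open>The quadratic form at the eigenvector \<open>col U i\<close> is \<open>e i\<close>, and
  this vector is nonzero because its entries have squared moduli summing to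
  \<open>1\<close>.\<close>

lemma strictly_positive_eigenvalues:
  assumes U: "unitary_mat d U" and pos: "strictly_positive d (spectral_mat d U e)" and i: "i < d"
  shows "0 < e i"
proof -
  note U' = unitary_matD[OF U]
  have c: "col U i \<in> carrier_vec d" using U'(1) i by auto
  have "col U i \<noteq> 0\<^sub>v d"
  proof
    assume *: "col U i = 0\<^sub>v d"
    have "U $$ (k, i) = 0" if "k < d" for k
      using arg_cong[OF *, of "\<lambda>v. vec_index v k"] that U'(1) i by simp
    then have "(\<Sum>k<d. cnj (U $$ (k, i)) * U $$ (k, i)) = 0" by simp
    then show False using unitary_cols[OF U i i] by simp
  qed
  then have "0 < Re ((spectral_mat d U e *\<^sub>v col U i) \<bullet>c col U i)"
    using pos c unfolding strictly_positive_def by blast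
  then show ?thesis unfolding quadratic_form_col[OF U i] by simp
qed

lemma strictly_positive_decomposition:
  assumes "strictly_positive d \<rho>"
  obtains U p where "unitary_mat d U" "\<rho> = spectral_mat d U p" "\<And>i. i < d \<Longrightarrow> 0 < p i"
proof -
  obtain U p where "unitary_mat d U" "\<rho> = spectral_mat d U p"
    using hermitian_spectral_decomposition assms unfolding strictly_positive_def by blast
  then show ?thesis using that strictly_positive_eigenvalues assms by blast
qed

text \<open>\<open>mat_inv\<close> strips an option, so \<open>mat_inverse\<close> has to be shown
  to succeed: the two-sided inverse \<open>B\<close> places \<open>A\<close> among the units of the
  matrix ring. The matrix returned then agrees with \<open>B\<close> by uniqueness of
  inverses.\<close>

lemma mat_inv_eqI:
  assumes A: "A \<in> carrier_mat d d" and B: "B \<in> carrier_mat d d"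
    and AB: "A * B = 1\<^sub>m d" and BA: "B * A = 1\<^sub>m d"
  shows "mat_inv A = B"
proof -
  have "A \<in> Units (ring_mat TYPE(complex) d undefined)"
    using assms unfolding Units_def ring_mat_def by auto
  then have "mat_inverse A \<noteq> None" using mat_inverse(1)[OF A, of undefined] by blast
  then obtain C where C: "mat_inverse A = Some C" by auto
  from mat_inverse(2)[OF A C] have "A * C = 1\<^sub>m d" "C \<in> carrier_mat d d" by auto
  then have "C = (B * A) * C" unfolding BA by simp
  also have "\<dots> = B * (A * C)" using A B \<open>C \<in> carrier_mat d d\<close> by simp
  also have "\<dots> = B" using \<open>A * C = 1\<^sub>m d\<close> B by simp
  finally show ?thesis using C by simp
qed

lemma mat_inv_spectral_mat:
  assumes U: "unitary_mat d U" and p: "\<And>i. i < d \<Longrightarrow> p i \<noteq> 0"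
  shows "mat_inv (spectral_mat d U p) = spectral_mat d U (\<lambda>i. 1 / p i)"
proof -
  note c = spectral_mat_carrier[OF unitary_matD(1)[OF U]]
  \<comment> \<open>\<open>p\<close> is known to be nonzero only below \<open>d\<close>, so the
    functions need not agree everywhere; the diagonal matrices of size \<open>d\<close> do.\<close>
  have cong: "spectral_mat d U (\<lambda>i. p i * (1 / p i)) = spectral_mat d U (\<lambda>i. 1)"
    "spectral_mat d U (\<lambda>i. 1 / p i * p i) = spectral_mat d U (\<lambda>i. 1)"
    unfolding spectral_mat_def mat_diag_def using p
    by (auto intro!: arg_cong[where f = "\<lambda>x. U * x * mat_adjoint U"] cong_mat)
  have one: "spectral_mat d U (\<lambda>i. 1) = 1\<^sub>m d"
    unfolding spectral_mat_const[OF U] by auto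
  show ?thesis
    by (rule mat_inv_eqI[OF c c]) (simp_all only: spectral_mat_mult[OF U] cong one)
qed

lemma f_entropy_spectral_mat:
  assumes U: "unitary_mat d U" and p: "\<And>i. i < d \<Longrightarrow> p i \<noteq> 0"
  shows "f_entropy f (spectral_mat d U p) = - (\<Sum>i<d. p i * f (1 / p i))"
proof -
  have "mat_inv (spectral_mat d U p) = spectral_mat d U (\<lambda>i. 1 / p i)"
    using mat_inv_spectral_mat[OF U] p by blast
  then show ?thesis
    unfolding f_entropy_def
    by (simp add: mat_fun_spectral_mat[OF U] spectral_mat_mult[OF U] trace_spectral_mat[OF U])
qed

section \<open>Strict convexity of non-affine operator convex functions\<close>

lemma convex_on_minus_affine:
  fixes f :: "real \<Rightarrow> real"
  assumes "convex_on I f"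
  shows "convex_on I (\<lambda>t. f t - (b + c * t))"
proof (rule convex_onI)
  fix t x y :: real assume "0 < t" "t < 1" "x \<in> I" "y \<in> I"
  then show "f ((1 - t) *\<^sub>R x + t *\<^sub>R y) - (b + c * ((1 - t) *\<^sub>R x + t *\<^sub>R y))
      \<le> (1 - t) * (f x - (b + c * x)) + t * (f y - (b + c * y))"
    using convex_onD[OF assms, of t x y] by (simp add: algebra_simps)
qed (use assms convex_on_imp_convex in blast)

text \<open>Beyond a chord a convex function cannot lie below the line through it. The zero nearer
  to \<open>t\<close> is a combination of the other zero and \<open>t\<close> with positive weight
  \<open>u\<close> on \<open>t\<close>, so a negative \<open>g t\<close> would make it
  negative.\<close>

lemma convex_on_nonneg_beyond_zeros:
  fixes g :: "real \<Rightarrow> real"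
  assumes g: "convex_on I g" and I: "p \<in> I" "q \<in> I" "t \<in> I"
    and pq: "p < q" and z: "g p = 0" "g q = 0" and t: "t \<le> p \<or> q \<le> t"
  shows "0 \<le> g t"
  using t
proof
  assume t: "q \<le> t"
  define u where "u = (q - p) / (t - p)"
  have u: "0 < u" "u \<le> 1" using pq t unfolding u_def by auto
  have "u * (t - p) = q - p" using pq t unfolding u_def by simp
  then have q: "(1 - u) *\<^sub>R p + u *\<^sub>R t = q" by (simp add: algebra_simps)
  have "g q \<le> (1 - u) * g p + u * g t"
    using convex_onD[OF g, of u p t] u I unfolding q by auto
  then show ?thesis using z u by (simp add: zero_le_mult_iff)
next
  assume t: "t \<le> p"
  define u where "u = (q - p) / (q - t)"
  have u: "0 < u" "u \<le> 1" using pq t unfolding u_def by auto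
  have "u * (q - t) = q - p" using pq t unfolding u_def by simp
  then have p: "(1 - u) *\<^sub>R q + u *\<^sub>R t = p" by (simp add: algebra_simps)
  have "g p \<le> (1 - u) * g q + u * g t"
    using convex_onD[OF g, of u q t] u I unfolding p by auto
  then show ?thesis using z u by (simp add: zero_le_mult_iff)
qed

section \<open>Scalar inequalities extracted from operator convexity\<close>

lemma loewner_le_diag:
  assumes "loewner_le d A B" and i: "i < d"
  shows "Re (A $$ (i, i)) \<le> Re (B $$ (i, i))"
proof -
  have A: "A \<in> carrier_mat d d" and B: "B \<in> carrier_mat d d" and psd: "psd_mat d (B - A)"
    using assms(1) unfolding loewner_le_def by auto
  have BA: "B - A \<in> carrier_mat d d" using A by (rule minus_carrier_mat)
  have uc: "unit_vec d i \<in> carrier_vec d" by simp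
  have "((B - A) *\<^sub>v unit_vec d i) \<bullet>c unit_vec d i =
      (\<Sum>r<d. if r = i then (B - A) $$ (r, i) else 0)"
    unfolding quadratic_form_index[OF BA uc]
  proof (intro sum.cong refl)
    fix r assume "r \<in> {..<d}"
    have "(\<Sum>s<d. (B - A) $$ (r, s) * vec_index (unit_vec d i) s) =
        (\<Sum>s<d. if s = i then (B - A) $$ (r, s) else 0)"
      by (intro sum.cong) (auto simp: i)
    then show "(\<Sum>s<d. (B - A) $$ (r, s) * vec_index (unit_vec d i) s) * cnj (vec_index (unit_vec d i) r)
        = (if r = i then (B - A) $$ (r, i) else 0)"
      using i \<open>r \<in> {..<d}\<close> by auto
  qed
  also have "\<dots> = B $$ (i, i) - A $$ (i, i)" using i A B by auto
  finally have "((B - A) *\<^sub>v unit_vec d i) \<bullet>c unit_vec d i = B $$ (i, i) - A $$ (i, i)" .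
  moreover have "0 \<le> Re (((B - A) *\<^sub>v unit_vec d i) \<bullet>c unit_vec d i)"
    using psd uc unfolding psd_mat_def by blast
  ultimately show ?thesis by simp
qed

lemma unitary_one_mat: "unitary_mat d (1\<^sub>m d)"
  by (rule unitary_colsI) (auto simp: if_distrib[of "\<lambda>x. x * _"] if_distrib[of cnj] cong: if_cong)

lemma hermitian_convex_combination:
  assumes "hermitian_mat d A" "hermitian_mat d B"
  shows "hermitian_mat d (complex_of_real l \<cdot>\<^sub>m A + complex_of_real l' \<cdot>\<^sub>m B)"
proof (rule hermitian_matI)
  have c: "A \<in> carrier_mat d d" "B \<in> carrier_mat d d"
    using assms unfolding hermitian_mat_def by auto
  then show "complex_of_real l \<cdot>\<^sub>m A + complex_of_real l' \<cdot>\<^sub>m B \<in> carrier_mat d d" by simp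
  fix i j assume "i < d" "j < d"
  then show "cnj ((complex_of_real l \<cdot>\<^sub>m A + complex_of_real l' \<cdot>\<^sub>m B) $$ (i, j)) =
      (complex_of_real l \<cdot>\<^sub>m A + complex_of_real l' \<cdot>\<^sub>m B) $$ (j, i)"
    using c hermitian_mat_index[OF assms(1)] hermitian_mat_index[OF assms(2)] by simp
qed

text \<open>This is the form in which the matrix inequality is applied: one diagonal entry,
  rewritten through the squared moduli of a row of each eigenbasis. Dimension one gives ordinary
  convexity, dimension two the propagation of affineness.\<close>

lemma operator_convex_onD_diag:
  assumes f: "operator_convex_on I f" and U: "unitary_mat d U" and V: "unitary_mat d V" and W: "unitary_mat d W"
    and eI: "\<And>i. i < d \<Longrightarrow> e i \<in> I" "\<And>i. i < d \<Longrightarrow> e' i \<in> I" and l: "0 \<le> l" "l \<le> 1"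
    and eq: "complex_of_real l \<cdot>\<^sub>m spectral_mat d U e + complex_of_real (1 - l) \<cdot>\<^sub>m spectral_mat d V e' =
      spectral_mat d W c"
    and r: "r < d"
  shows "(\<Sum>i<d. f (c i) * (cmod (W $$ (r, i)))\<^sup>2) \<le>
    l * (\<Sum>i<d. f (e i) * (cmod (U $$ (r, i)))\<^sup>2) + (1 - l) * (\<Sum>i<d. f (e' i) * (cmod (V $$ (r, i)))\<^sup>2)"
proof -
  note Uc = unitary_matD(1)[OF U] and Vc = unitary_matD(1)[OF V] and Wc = unitary_matD(1)[OF W]
  have "loewner_le d (mat_fun f (spectral_mat d W c))
      (complex_of_real l \<cdot>\<^sub>m mat_fun f (spectral_mat d U e) +
       complex_of_real (1 - l) \<cdot>\<^sub>m mat_fun f (spectral_mat d V e'))"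
    using f l eI unfolding operator_convex_on_def eq[symmetric]
    by (simp add: spectral_mat_hermitian[OF Uc] spectral_mat_hermitian[OF Vc]
        spectrum_in_spectral_mat[OF U] spectrum_in_spectral_mat[OF V])
  from loewner_le_diag[OF this r] show ?thesis
    unfolding mat_fun_spectral_mat[OF U] mat_fun_spectral_mat[OF V] mat_fun_spectral_mat[OF W]
    using r Uc Vc
    by (simp add: spectral_mat_diag_index[OF Wc r] spectral_mat_diag_index[OF Uc r]
        spectral_mat_diag_index[OF Vc r])
qed

lemma unitary_row_norm:
  assumes U: "unitary_mat d U" and r: "r < d"
  shows "(\<Sum>i<d. (cmod (U $$ (r, i)))\<^sup>2) = 1"
proof -
  have "complex_of_real (\<Sum>i<d. (cmod (U $$ (r, i)))\<^sup>2) = (\<Sum>i<d. U $$ (r, i) * cnj (U $$ (r, i)))"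
    by (simp add: complex_norm_square del: of_real_power)
  then show ?thesis unfolding unitary_rows[OF U r r] by (simp del: of_real_sum)
qed

lemma operator_convex_on_imp_convex_on:
  assumes f: "operator_convex_on I f"
  shows "convex_on I f"
proof (rule convex_onI)
  show "convex I" using f unfolding operator_convex_on_def by (simp add: is_interval_convex)
  fix t x y :: real assume t: "0 < t" "t < 1" and xy: "x \<in> I" "y \<in> I"
  note one = unitary_one_mat[of 1]
  \<comment> \<open>The matrix inequality is taken with \<open>l = 1 - t\<close>, so the second
    weight appears as \<open>1 - (1 - t)\<close>.\<close>
  have eq: "complex_of_real (1 - t) \<cdot>\<^sub>m spectral_mat 1 (1\<^sub>m 1) (\<lambda>_. x) +
      complex_of_real (1 - (1 - t)) \<cdot>\<^sub>m spectral_mat 1 (1\<^sub>m 1) (\<lambda>_. y) =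
      spectral_mat 1 (1\<^sub>m 1) (\<lambda>_. (1 - t) * x + t * y)"
    unfolding spectral_mat_const[OF one] by (intro eq_matI) auto
  show "f ((1 - t) *\<^sub>R x + t *\<^sub>R y) \<le> (1 - t) * f x + t * f y"
    using operator_convex_onD_diag[OF f one one one _ _ _ _ eq, of 0] t xy by simp
qed

text \<open>Test operator convexity in dimension two: the convex combination \<open>C\<close> of a non-diagonal matrix \<open>A\<close> with
  eigenvalues \<open>m\<close>, \<open>M\<close> and of \<open>B = diag(s, h)\<close> has no eigenvector along a coordinate axis.
  Subtracting the affine function leaves \<open>g \<ge> 0\<close> with \<open>g(A) = 0\<close> and \<open>g(B)\<close> supported on the first
  axis, so operator convexity makes the lower diagonal entry of \<open>g(C)\<close> vanish, hence \<open>g\<close> vanishes on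
  the spectrum of \<open>C\<close>; but the upper diagonal entry of \<open>C\<close> is close to \<open>s\<close>.\<close>

lemma operator_convex_affine_extends:
  assumes f: "operator_convex_on I f" and mM: "m \<in> I" "M \<in> I" "m < M"
    and aff: "\<And>t. m \<le> t \<Longrightarrow> t \<le> M \<Longrightarrow> f t = b + c * t"
    and s: "s \<in> interior I"
  shows "f s = b + c * s"
proof (rule ccontr)
  assume neq: "f s \<noteq> b + c * s"
  have cf: "convex_on I f" by (rule operator_convex_on_imp_convex_on[OF f])
  have int: "is_interval I" using f unfolding operator_convex_on_def by blast
  define g where "g t = f t - (b + c * t)" for t
  have cg: "convex_on I g" unfolding g_def[abs_def] by (rule convex_on_minus_affine[OF cf])
  have g0: "g t = 0" if "m \<le> t" "t \<le> M" for t using aff[OF that] unfolding g_def by simp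
  have gpos: "0 \<le> g t" if "t \<in> I" for t
    using convex_on_nonneg_beyond_zeros[OF cg mM(1,2) that mM(3)] g0 mM(3)
    by (cases "m \<le> t \<and> t \<le> M") auto
  have sI: "s \<in> I" using s interior_subset by auto
  have gs: "0 < g s" using gpos[OF sI] neq unfolding g_def by auto
  \<comment> \<open>Centre and half-length of the affine interval. Conjugating diag(M, m) by the
    Hadamard matrix \<open>H\<close> below gives diagonal entries \<open>h\<close> and off-diagonal
    entries \<open>k\<close>. Since the lower entry of diag(s, h) is \<open>h\<close> as well, the
    lower diagonal entry of \<open>C\<close> is \<open>h\<close> for every weight
    \<open>l\<close>.\<close>
  define h k where "h = (m + M) / 2" and "k = (M - m) / 2"
  have hk: "m \<le> h" "h \<le> M" "0 < k" "h - k = m" "h + k = M"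
    using mM(3) unfolding h_def k_def by (auto simp: field_simps)
  have hI: "h \<in> I" using mem_is_interval_1_I[OF int mM(1,2) hk(1,2)] .
  \<comment> \<open>Continuity of a convex function on the open interior allows a weight
    \<open>l\<close> so small that \<open>g\<close> is still positive at
    \<open>l * h + (1 - l) * s\<close>, the upper diagonal entry of \<open>C\<close>.\<close>
  have "continuous_on (interior I) g"
    by (rule convex_on_continuous[OF open_interior])
      (rule convex_on_subset[OF cg interior_subset convex_interior[OF convex_on_imp_convex[OF cg]]])
  then have "isCont g s" using s by (simp add: continuous_on_eq_continuous_at)
  then have "isCont (\<lambda>l. g (l * h + (1 - l) * s)) 0"
    using isCont_o2[of 0 "\<lambda>l. l * h + (1 - l) * s" g] by simp
  then have "((\<lambda>l. g (l * h + (1 - l) * s)) \<longlongrightarrow> g s) (at_right 0)"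
    unfolding isCont_def by (simp add: filterlim_at_split)
  then have "\<forall>\<^sub>F l in at_right 0. 0 < g (l * h + (1 - l) * s)"
    using gs by (rule order_tendstoD)
  moreover have "\<forall>\<^sub>F l in at_right (0::real). 0 < l \<and> l < 1"
    unfolding eventually_at_right_field by (intro exI[of _ 1]) auto
  ultimately have "\<forall>\<^sub>F l in at_right 0. 0 < g (l * h + (1 - l) * s) \<and> 0 < l \<and> l < 1"
    by (rule eventually_conj)
  then obtain l where l: "0 < l" "l < 1" and gl: "0 < g (l * h + (1 - l) * s)"
    using eventually_happens'[OF trivial_limit_at_right_real] by blast
  define H :: "complex mat" where
    "H = mat 2 2 (\<lambda>(i, j). complex_of_real (if i = 1 \<and> j = 1 then - (1 / sqrt 2) else 1 / sqrt 2))"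
  have Hc: "H \<in> carrier_mat 2 2" unfolding H_def by auto
  have two: "{..<2::nat} = {0, 1}" by auto
  have less2: "i < 2 \<longleftrightarrow> i = 0 \<or> i = 1" for i :: nat by auto
  have half: "complex_of_real (sqrt 2) * complex_of_real (sqrt 2) = 2"
    by (simp flip: of_real_mult)
  have Hi: "H $$ (0, 0) = 1 / complex_of_real (sqrt 2)" "H $$ (0, 1) = 1 / complex_of_real (sqrt 2)"
    "H $$ (1, 0) = 1 / complex_of_real (sqrt 2)" "H $$ (1, 1) = - 1 / complex_of_real (sqrt 2)"
    unfolding H_def by auto
  have H: "unitary_mat 2 H"
    by (rule unitary_colsI[OF Hc]) (auto simp: two less2 Hi half simp del: One_nat_def)
  note one = unitary_one_mat[of 2]
  have onec: "1\<^sub>m 2 \<in> carrier_mat 2 2" by simp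
  define e e' where "e i = (if i = 0 then M else m)" and "e' i = (if i = 0 then s else h)" for i :: nat
  define C where "C = complex_of_real l \<cdot>\<^sub>m spectral_mat 2 H e +
    complex_of_real (1 - l) \<cdot>\<^sub>m spectral_mat 2 (1\<^sub>m 2) e'"
  have "hermitian_mat 2 C"
    unfolding C_def
    by (rule hermitian_convex_combination[OF spectral_mat_hermitian[OF Hc] spectral_mat_hermitian[OF onec]])
  then obtain U d where U: "unitary_mat 2 U" and CU: "C = spectral_mat 2 U d"
    using hermitian_spectral_decomposition by blast
  note U' = unitary_matD[OF U]
  have Ci: "C $$ (i, j) = complex_of_real l * spectral_mat 2 H e $$ (i, j) +
      complex_of_real (1 - l) * spectral_mat 2 (1\<^sub>m 2) e' $$ (i, j)" if "i < 2" "j < 2" for i j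
    using that Hc unfolding C_def by simp
  have C00: "C $$ (0, 0) = complex_of_real (l * h + (1 - l) * s)"
    and C11: "C $$ (1, 1) = complex_of_real h"
    and C01: "C $$ (0, 1) = complex_of_real (l * k)"
    and C10: "C $$ (1, 0) = complex_of_real (l * k)"
    using half
    by (simp_all add: Ci spectral_mat_index[OF Hc] spectral_mat_index[OF onec] two Hi e_def e'_def
        h_def k_def field_simps del: One_nat_def)
  have eigen0: "complex_of_real (l * h + (1 - l) * s) * U $$ (0, i) + complex_of_real (l * k) * U $$ (1, i) =
      complex_of_real (d i) * U $$ (0, i)"
    and eigen1: "complex_of_real (l * k) * U $$ (0, i) + complex_of_real h * U $$ (1, i) =
      complex_of_real (d i) * U $$ (1, i)" if "i < 2" for i
    using spectral_mat_eigen[OF U, of 0 i d] spectral_mat_eigen[OF U, of 1 i d] that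
    unfolding CU[symmetric] two by (simp_all add: C00 C01 C10 C11 del: One_nat_def)
  have norm1: "(cmod (U $$ (0, i)))\<^sup>2 + (cmod (U $$ (1, i)))\<^sup>2 = 1" if "i < 2" for i
  proof -
    have "complex_of_real ((cmod (U $$ (0, i)))\<^sup>2 + (cmod (U $$ (1, i)))\<^sup>2) = 1"
      using unitary_cols[OF U that that]
      by (simp add: two complex_norm_square mult.commute del: of_real_power One_nat_def)
    then show ?thesis by (simp only: of_real_eq_1_iff)
  qed
  \<comment> \<open>Numerical range argument: for the unit eigenvector with coordinates
    \<open>a\<close>, \<open>a'\<close> the eigenvalue is a combination of the quadratic forms of
    the two matrices. That of diag(s, h) is an average of \<open>s\<close> and \<open>h\<close>;
    that of the non-diagonal matrix is \<open>h + k * R\<close>, which lies between \<open>m\<close>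
    and \<open>M\<close>.\<close>
  have dI: "d i \<in> I" if i: "i < 2" for i
  proof -
    define a where "a = U $$ (0, i)"
    define a' where "a' = U $$ (1, i)"
    define R where "R = 2 * (Re a * Re a' + Im a * Im a')"
    note n = norm1[OF i, folded a_def a'_def]
    have "complex_of_real (d i) = complex_of_real (d i) * (cnj a * a + cnj a' * a')"
      using n by (simp add: complex_norm_square[symmetric] mult.commute[of "cnj _"]
          flip: of_real_add del: of_real_power)
    also have "\<dots> = cnj a * (complex_of_real (l * h + (1 - l) * s) * a + complex_of_real (l * k) * a') +
       cnj a' * (complex_of_real (l * k) * a + complex_of_real h * a')"
      unfolding eigen0[OF i, folded a_def a'_def] eigen1[OF i, folded a_def a'_def]
      by (simp add: algebra_simps)
    finally have "Re (complex_of_real (d i)) = Re (cnj a * (complex_of_real (l * h + (1 - l) * s) * a + complex_of_real (l * k) * a') +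
       cnj a' * (complex_of_real (l * k) * a + complex_of_real h * a'))" by simp
    then have "d i = (l * h + (1 - l) * s) * (cmod a)\<^sup>2 + h * (cmod a')\<^sup>2 + l * k * R"
      unfolding R_def cmod_power2 by (simp add: algebra_simps power2_eq_square)
    also have "\<dots> = (1 - l) * ((cmod a)\<^sup>2 * s + (cmod a')\<^sup>2 * h) + l * (h * ((cmod a)\<^sup>2 + (cmod a')\<^sup>2) + k * R)"
      by (simp add: algebra_simps)
    finally have di: "d i = (1 - l) * ((cmod a)\<^sup>2 * s + (cmod a')\<^sup>2 * h) + l * (h + k * R)"
      unfolding n by simp
    \<comment> \<open>The squared moduli of \<open>a + a'\<close> and \<open>a - a'\<close> are
      nonnegative; as the vector has norm one, this bounds \<open>R\<close> by \<open>1\<close> in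
      absolute value.\<close>
    have "0 \<le> (Re a + Re a')\<^sup>2 + (Im a + Im a')\<^sup>2" "0 \<le> (Re a - Re a')\<^sup>2 + (Im a - Im a')\<^sup>2" by simp_all
    then have R: "- 1 \<le> R" "R \<le> 1"
      using n unfolding R_def cmod_power2 by (simp_all add: power2_eq_square algebra_simps)
    have "k * -1 \<le> k * R" "k * R \<le> k * 1" using R hk(3) by (intro mult_left_mono; simp)+
    then have "m \<le> h + k * R" "h + k * R \<le> M" using hk by auto
    then have 1: "h + k * R \<in> I" using mem_is_interval_1_I[OF int mM(1,2)] by blast
    have cI: "convex I" using int by (simp add: is_interval_convex)
    have 2: "(cmod a)\<^sup>2 * s + (cmod a')\<^sup>2 * h \<in> I"
      using convexD[OF cI sI hI _ _ n] by simp
    show ?thesis unfolding di using convexD[OF cI 2 1, of "1 - l" l] l by simp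
  qed
  have "(\<Sum>i<2. f (d i) * (cmod (U $$ (1, i)))\<^sup>2) \<le>
      l * (\<Sum>i<2. f (e i) * (cmod (H $$ (1, i)))\<^sup>2) + (1 - l) * (\<Sum>i<2. f (e' i) * (cmod (1\<^sub>m 2 $$ (1, i) :: complex))\<^sup>2)"
    by (rule operator_convex_onD_diag[OF f H one U _ _ _ _ CU[unfolded C_def]])
      (use mM sI hI l in \<open>auto simp: e_def e'_def\<close>)
  also have "\<dots> = l * ((f M + f m) / 2) + (1 - l) * f h"
    by (simp add: two Hi e_def e'_def norm_divide power_divide field_simps del: One_nat_def)
  also have "\<dots> = b + c * h"
    using aff[of M] aff[of m] aff[of h] hk mM(3) unfolding h_def by (simp add: field_simps)
  finally have fU: "(\<Sum>i<2. f (d i) * (cmod (U $$ (1, i)))\<^sup>2) \<le> b + c * h" .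
  have diag: "(\<Sum>i<2. d i * (cmod (U $$ (1, i)))\<^sup>2) = h"
    "(\<Sum>i<2. d i * (cmod (U $$ (0, i)))\<^sup>2) = l * h + (1 - l) * s"
    using spectral_mat_diag_index[OF U'(1), of 1 d] spectral_mat_diag_index[OF U'(1), of 0 d]
    unfolding CU[symmetric] C11 C00 of_real_eq_iff by simp_all
  \<comment> \<open>The affine part averages to exactly \<open>b + c * h\<close>, since the row has
    norm one and the eigenvalues average to the diagonal entry \<open>h\<close>.\<close>
  have "(\<Sum>i<2. g (d i) * (cmod (U $$ (1, i)))\<^sup>2) =
      (\<Sum>i<2. f (d i) * (cmod (U $$ (1, i)))\<^sup>2) - (b * (\<Sum>i<2. (cmod (U $$ (1, i)))\<^sup>2) +
        c * (\<Sum>i<2. d i * (cmod (U $$ (1, i)))\<^sup>2))"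
    unfolding g_def sum_distrib_left sum_subtractf[symmetric] sum.distrib[symmetric]
    by (intro sum.cong) (auto simp: algebra_simps)
  also have "\<dots> \<le> 0" unfolding diag using fU unitary_row_norm[OF U, of 1] by simp
  finally have "(\<Sum>i<2. g (d i) * (cmod (U $$ (1, i)))\<^sup>2) \<le> 0" .
  moreover have nn: "0 \<le> g (d i) * (cmod (U $$ (1, i)))\<^sup>2" if "i < 2" for i
    using gpos[OF dI[OF that]] by simp
  ultimately have "(\<Sum>i<2. g (d i) * (cmod (U $$ (1, i)))\<^sup>2) = 0"
    by (intro antisym sum_nonneg) auto
  then have z: "g (d i) * (cmod (U $$ (1, i)))\<^sup>2 = 0" if "i < 2" for i
    using sum_nonneg_eq_0_iff[of "{..<2}" "\<lambda>i. g (d i) * (cmod (U $$ (1, i)))\<^sup>2"] nn that by auto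
  \<comment> \<open>If the lower coordinate vanished, the second eigenvalue equation with
    \<open>l * k\<close> positive would make the upper one vanish too, against norm one.\<close>
  have "U $$ (1, i) \<noteq> 0" if "i < 2" for i
    using eigen1[OF that] norm1[OF that] l hk(3) by auto
  with z have gd: "g (d i) = 0" if "i < 2" for i using that by auto
  \<comment> \<open>The upper diagonal entry of \<open>C\<close> is an average of the eigenvalues,
    so Jensen gives \<open>g \<le> 0\<close> there, where \<open>l\<close> was chosen to make
    \<open>g\<close> positive.\<close>
  have "g (\<Sum>i<2. (cmod (U $$ (0, i)))\<^sup>2 *\<^sub>R d i) \<le> (\<Sum>i<2. (cmod (U $$ (0, i)))\<^sup>2 * g (d i))"
    by (rule convex_on_sum[OF _ _ cg unitary_row_norm[OF U]]) (auto intro: dI simp: two)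
  also have "\<dots> = 0" using gd by simp
  finally have "g (\<Sum>i<2. d i * (cmod (U $$ (0, i)))\<^sup>2) \<le> 0" by (simp add: mult.commute)
  then show False using gl unfolding diag by simp
qed

text \<open>If strictness fails at one inner point \<open>w\<close> of a chord, then
  \<open>g\<close>, the difference of \<open>f\<close> and the chord, vanishes at \<open>x\<close>,
  \<open>w\<close> and \<open>y\<close>. It is nonpositive between \<open>x\<close> and
  \<open>y\<close> by convexity, and nonnegative because each point lies beyond one of the pairs of
  zeros \<open>x\<close>, \<open>w\<close> and \<open>w\<close>, \<open>y\<close>. So
  \<open>f\<close> is affine from \<open>x\<close> to \<open>y\<close>, hence on the interior of
  \<open>I\<close>.\<close>

lemma operator_convex_strict:
  assumes f: "operator_convex_on I f" and na: "non_affine_on I f"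
    and xy: "x \<in> I" "y \<in> I" "x \<noteq> y" and t: "0 < t" "t < 1"
  shows "f ((1 - t) * x + t * y) < (1 - t) * f x + t * f y"
proof -
  have cf: "convex_on I f" by (rule operator_convex_on_imp_convex_on[OF f])
  have main: "f ((1 - t) * x + t * y) < (1 - t) * f x + t * f y"
    if xy: "x \<in> I" "y \<in> I" "x < y" and t: "0 < t" "t < 1" for x y t :: real
  proof (rule ccontr)
    assume *: "\<not> ?thesis"
    define w where "w = (1 - t) * x + t * y"
    have w: "x < w" "w < y"
    proof -
      have "0 < t * (y - x)" "0 < (1 - t) * (y - x)" using t xy by simp_all
      then show "x < w" "w < y" unfolding w_def by (simp_all add: algebra_simps)
    qed
    define c where "c = (f y - f x) / (y - x)"
    define b where "b = f x - c * x"
    define g where "g t = f t - (b + c * t)" for t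
    have cg: "convex_on I g" unfolding g_def[abs_def] by (rule convex_on_minus_affine[OF cf])
    have "c * (y - x) = f y - f x" using xy unfolding c_def by simp
    then have gx: "g x = 0" and gy: "g y = 0" unfolding g_def b_def by (simp_all add: algebra_simps)
    have fx: "f x = b + c * x" and fy: "f y = b + c * y" using gx gy unfolding g_def by simp_all
    have "0 \<le> g w" using * unfolding w_def[symmetric] g_def fx fy unfolding w_def
      by (simp add: algebra_simps)
    have up: "g u \<le> 0" if "x \<le> u" "u \<le> y" for u
    proof -
      define r where "r = (u - x) / (y - x)"
      have r: "0 \<le> r" "r \<le> 1" using that xy unfolding r_def by auto
      have "r * (y - x) = u - x" using xy unfolding r_def by simp
      then have u: "(1 - r) *\<^sub>R x + r *\<^sub>R y = u" by (simp add: algebra_simps)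
      show ?thesis using convex_onD[OF cg r xy(1,2)] unfolding u gx gy by simp
    qed
    have gw: "g w = 0" using \<open>0 \<le> g w\<close> up[of w] w by simp
    have int: "is_interval I" using f unfolding operator_convex_on_def by blast
    have uI: "u \<in> I" if "x \<le> u" "u \<le> y" for u using mem_is_interval_1_I[OF int xy(1,2) that] .
    have "f u = b + c * u" if u: "x \<le> u" "u \<le> y" for u
    proof -
      have "0 \<le> g u"
      proof (cases "u \<le> w")
        case True
        then show ?thesis
          using convex_on_nonneg_beyond_zeros[OF cg uI[of w] xy(2) uI[OF u] w(2) gw gy] w by auto
      next
        case False
        then show ?thesis
          using convex_on_nonneg_beyond_zeros[OF cg xy(1) uI[of w] uI[OF u] w(1) gx gw] w by auto
      qed
      then show ?thesis using up[OF u] unfolding g_def by simp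
    qed
    then have "\<forall>s\<in>interior I. f s = b + c * s"
      using operator_convex_affine_extends[OF f xy] by blast
    then show False using na unfolding non_affine_on_def affine_fun_on_def by blast
  qed
  show ?thesis
  proof (cases "x < y")
    case True then show ?thesis using main[OF xy(1,2) True t] by simp
  next
    case False
    then show ?thesis using main[of y x "1 - t"] xy t by (simp add: add.commute)
  qed
qed

text \<open>Inversion changes the weights: the reciprocal of the mean \<open>r\<close> is a mean of
  the reciprocals with weights proportional to \<open>(1 - t) * p\<close> and \<open>t * q\<close>,
  and the outer factor \<open>r\<close> of the perspective cancels this reweighting. The algebra
  serves both convexity and its strict version.\<close>

lemma perspective_combination:
  fixes p q t :: real
  assumes pq: "0 < p" "0 < q" and t: "0 < t" "t < 1"
  defines "r \<equiv> (1 - t) * p + t * q"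
  defines "u \<equiv> t * q / r"
  shows "0 < r" "0 < u" "u < 1" "1 / r = (1 - u) * (1 / p) + u * (1 / q)"
    "r * ((1 - u) * a + u * b) = (1 - t) * (p * a) + t * (q * b)"
proof -
  have tp: "0 < (1 - t) * p" "0 < t * q" using pq t by simp_all
  then show r: "0 < r" unfolding r_def by simp
  show "0 < u" "u < 1" using tp r unfolding u_def by (simp_all add: r_def)
  have u: "u * r = t * q" using r unfolding u_def by simp
  have v: "(1 - u) * r = (1 - t) * p" using u unfolding r_def by (simp add: algebra_simps)
  have "r * ((1 - u) * a + u * b) = ((1 - u) * r) * a + (u * r) * b" by (simp add: algebra_simps)
  then show "r * ((1 - u) * a + u * b) = (1 - t) * (p * a) + t * (q * b)" unfolding u v by simp
  have "r * ((1 - u) * (1 / p) + u * (1 / q)) = ((1 - u) * r) / p + (u * r) / q"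
    by (simp add: algebra_simps)
  also have "\<dots> = 1" unfolding u v using pq by simp
  finally show "1 / r = (1 - u) * (1 / p) + u * (1 / q)" using r by (simp add: field_simps)
qed

lemma perspective_convex:
  fixes f :: "real \<Rightarrow> real"
  assumes f: "convex_on I f"
  shows "convex_on {p. 0 < p \<and> 1 / p \<in> I} (\<lambda>p. p * f (1 / p))"
proof -
  have cI: "convex I" using f convex_on_imp_convex by blast
  have mem: "(1 - t) * p + t * q \<in> {p. 0 < p \<and> 1 / p \<in> I}"
    if "0 < p" "0 < q" "1 / p \<in> I" "1 / q \<in> I" "0 < t" "t < 1" for p q t
  proof -
    define r where "r = (1 - t) * p + t * q"
    define u where "u = t * q / r"
    note c = perspective_combination[OF that(1,2,5,6), folded r_def, folded u_def]
    have "1 / r \<in> I"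
      unfolding c(4) using convexD[OF cI that(3,4), of "1 - u" u] c(2,3) by simp
    then show ?thesis using c(1) unfolding r_def by simp
  qed
  show ?thesis
  proof (rule convex_onI)
    fix t p q :: real
    assume t: "0 < t" "t < 1" and "p \<in> {p. 0 < p \<and> 1 / p \<in> I}" "q \<in> {p. 0 < p \<and> 1 / p \<in> I}"
    then have pq: "0 < p" "0 < q" "1 / p \<in> I" "1 / q \<in> I" by auto
    define r where "r = (1 - t) * p + t * q"
    define u where "u = t * q / r"
    note c = perspective_combination[OF pq(1,2) t, folded r_def, folded u_def]
    have "f (1 / r) \<le> (1 - u) * f (1 / p) + u * f (1 / q)"
      unfolding c(4) using convex_onD[OF f, of u "1 / p" "1 / q"] pq c(2,3) by simp
    then have "r * f (1 / r) \<le> r * ((1 - u) * f (1 / p) + u * f (1 / q))"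
      using c(1) by simp
    then show "((1 - t) *\<^sub>R p + t *\<^sub>R q) * f (1 / ((1 - t) *\<^sub>R p + t *\<^sub>R q))
        \<le> (1 - t) * (p * f (1 / p)) + t * (q * f (1 / q))"
      unfolding c(5) by (simp add: r_def)
  next
    show "convex {p. 0 < p \<and> 1 / p \<in> I}"
    proof (unfold convex_alt, intro ballI allI impI)
      fix p q u :: real
      assume "p \<in> {p. 0 < p \<and> 1 / p \<in> I}" "q \<in> {p. 0 < p \<and> 1 / p \<in> I}" "0 \<le> u \<and> u \<le> 1"
      then show "(1 - u) *\<^sub>R p + u *\<^sub>R q \<in> {p. 0 < p \<and> 1 / p \<in> I}"
        using mem[of p q u] by (cases "u = 0 \<or> u = 1") auto
    qed
  qed
qed

text \<open>Inversion is injective and the new weight \<open>u\<close> lies strictly between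
  \<open>0\<close> and \<open>1\<close>, so strictness of \<open>f\<close> at the reciprocals
  carries over.\<close>

lemma perspective_strict:
  fixes f :: "real \<Rightarrow> real"
  assumes f: "\<And>x y t. x \<in> I \<Longrightarrow> y \<in> I \<Longrightarrow> x \<noteq> y \<Longrightarrow> 0 < t \<Longrightarrow> t < 1 \<Longrightarrow>
      f ((1 - t) * x + t * y) < (1 - t) * f x + t * f y"
    and pq: "0 < p" "0 < q" "1 / p \<in> I" "1 / q \<in> I" "p \<noteq> q" and t: "0 < t" "t < 1"
  shows "((1 - t) * p + t * q) * f (1 / ((1 - t) * p + t * q))
      < (1 - t) * (p * f (1 / p)) + t * (q * f (1 / q))"
proof -
  define r where "r = (1 - t) * p + t * q"
  define u where "u = t * q / r"
  note c = perspective_combination[OF pq(1,2) t, folded r_def, folded u_def]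
  have "f (1 / r) < (1 - u) * f (1 / p) + u * f (1 / q)"
    unfolding c(4) using f[of "1 / p" "1 / q" u] pq c(2,3) by simp
  then have "r * f (1 / r) < r * ((1 - u) * f (1 / p) + u * f (1 / q))" using c(1) by simp
  then show ?thesis unfolding c(5) r_def[symmetric] .
qed

text \<open>Singling out index \<open>i\<close> reduces the claim to two points: the mean is
  \<open>(1 - t) * p i + t * r\<close> with \<open>r\<close> the mean of the remaining points.
  Jensen for those leaves a two-point inequality that would be strict unless \<open>p i = r\<close>.
  Only indices of positive weight are pinned to the mean.\<close>

lemma strict_jensen_equality:
  fixes h :: "real \<Rightarrow> real"
  assumes h: "convex_on S h"
    and strict: "\<And>x y t. x \<in> S \<Longrightarrow> y \<in> S \<Longrightarrow> x \<noteq> y \<Longrightarrow> 0 < t \<Longrightarrow> t < 1 \<Longrightarrow>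
      h ((1 - t) * x + t * y) < (1 - t) * h x + t * h y"
    and A: "finite A" and w: "\<And>i. i \<in> A \<Longrightarrow> 0 \<le> w i" "sum w A = 1" and p: "\<And>i. i \<in> A \<Longrightarrow> p i \<in> S"
    and eq: "(\<Sum>i\<in>A. w i * h (p i)) \<le> h (\<Sum>i\<in>A. w i * p i)"
    and i: "i \<in> A" "0 < w i"
  shows "p i = (\<Sum>i\<in>A. w i * p i)"
proof -
  define t where "t = sum w (A - {i})"
  have wt: "w i = 1 - t" using sum.remove[OF A i(1), of w] w(2) unfolding t_def by simp
  have t0: "0 \<le> t" unfolding t_def using w(1) by (intro sum_nonneg) auto
  have split: "(\<Sum>j\<in>A. w j * F j) = (1 - t) * F i + (\<Sum>j\<in>A - {i}. w j * F j)" for F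
    using sum.remove[OF A i(1), of "\<lambda>j. w j * F j"] wt by simp
  show ?thesis
  proof (cases "t = 0")
    \<comment> \<open>All weight sits on \<open>i\<close>, so the mean is \<open>p i\<close> itself
      and \<open>r\<close> would be undefined as an average.\<close>
    case True
    then have "w j = 0" if "j \<in> A - {i}" for j
      using sum_nonneg_eq_0_iff[of "A - {i}" w] A w(1) that unfolding t_def by auto
    then show ?thesis unfolding split True by simp
  next
    case False
    with t0 have t: "0 < t" by simp
    define r where "r = (\<Sum>j\<in>A - {i}. (w j / t) * p j)"
    have ne: "A - {i} \<noteq> {}"
    proof
      assume "A - {i} = {}"
      then have "t = 0" unfolding t_def by (simp only: sum.empty)
      then show False using t by simp
    qed
    have wr: "(\<Sum>j\<in>A - {i}. w j / t) = 1" using t unfolding t_def by (simp add: sum_divide_distrib[symmetric])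
    have tr: "(\<Sum>j\<in>A - {i}. w j * F j) = t * (\<Sum>j\<in>A - {i}. (w j / t) * F j)" for F
      using t by (simp add: sum_distrib_left)
    have rS: "r \<in> S"
      unfolding r_def using convex_sum[of "A - {i}" S "\<lambda>j. w j / t" p] A w(1) p wr t convex_on_imp_convex[OF h]
      by simp
    have "h r \<le> (\<Sum>j\<in>A - {i}. (w j / t) * h (p j))"
      unfolding r_def using convex_on_sum[OF _ ne h wr, of p] A w(1) p t by simp
    then have "t * h r \<le> (\<Sum>j\<in>A - {i}. w j * h (p j))" unfolding tr[of "\<lambda>j. h (p j)"] using t by simp
    moreover have m: "(\<Sum>i\<in>A. w i * p i) = (1 - t) * p i + t * r"
      unfolding split tr[of p] r_def ..
    ultimately have le: "(1 - t) * h (p i) + t * h r \<le> h ((1 - t) * p i + t * r)"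
      using eq unfolding split[of "\<lambda>j. h (p j)"] by simp
    have "p i = r"
    proof (rule ccontr)
      assume "p i \<noteq> r"
      from strict[OF p[OF i(1)] rS this t] le i(2) wt show False by simp
    qed
    then show ?thesis unfolding m by (simp add: algebra_simps)
  qed
qed

section \<open>Maximally mixed states and reduced states\<close>

lemma strictly_positive_inv_spectrum:
  assumes "strictly_positive d \<rho>" "spectrum_in (mat_inv \<rho>) I"
  obtains U p where "unitary_mat d U" "\<rho> = spectral_mat d U p"
    "\<And>i. i < d \<Longrightarrow> 0 < p i" "\<And>i. i < d \<Longrightarrow> 1 / p i \<in> I"
proof -
  obtain U p where U: "unitary_mat d U" and \<rho>: "\<rho> = spectral_mat d U p"
    and p: "\<And>i. i < d \<Longrightarrow> 0 < p i"
    using strictly_positive_decomposition[OF assms(1)] by blast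
  have "mat_inv \<rho> = spectral_mat d U (\<lambda>i. 1 / p i)"
    unfolding \<rho> by (rule mat_inv_spectral_mat[OF U]) (use p in force)
  then have "\<And>i. i < d \<Longrightarrow> 1 / p i \<in> I"
    using assms(2) spectrum_in_spectral_mat[OF U] by simp
  then show ?thesis using that U \<rho> p by blast
qed

lemma f_entropy_strictly_positive:
  assumes "unitary_mat d U" "\<And>i. i < d \<Longrightarrow> 0 < p i"
  shows "f_entropy f (spectral_mat d U p) = - (\<Sum>i<d. p i * f (1 / p i))"
  by (rule f_entropy_spectral_mat[OF assms(1)]) (use assms(2) in force)

text \<open>Jensen is used with equal weights \<open>1 / d\<close> and multiplied by
  \<open>d\<close>. As all these weights are positive, equality pins every eigenvalue to the
  mean.\<close>

lemma f_entropy_le_maximally_mixed: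
  assumes cf: "convex_on I f" and pos: "strictly_positive d \<rho>" and spec: "spectrum_in (mat_inv \<rho>) I"
  shows "f_entropy f \<rho> \<le> - Re (trace_mat \<rho>) * f (real d / Re (trace_mat \<rho>))"
    and "(\<And>x y t. x \<in> I \<Longrightarrow> y \<in> I \<Longrightarrow> x \<noteq> y \<Longrightarrow> 0 < t \<Longrightarrow> t < 1 \<Longrightarrow>
        f ((1 - t) * x + t * y) < (1 - t) * f x + t * f y) \<Longrightarrow>
      f_entropy f \<rho> = - Re (trace_mat \<rho>) * f (real d / Re (trace_mat \<rho>)) \<longleftrightarrow>
      \<rho> = (trace_mat \<rho> / of_nat d) \<cdot>\<^sub>m 1\<^sub>m d"
proof -
  let ?S = "{p. 0 < p \<and> 1 / p \<in> I}" and ?h = "\<lambda>p. p * f (1 / p)"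
  obtain U p where U: "unitary_mat d U" and \<rho>: "\<rho> = spectral_mat d U p"
    and p: "\<And>i. i < d \<Longrightarrow> 0 < p i" "\<And>i. i < d \<Longrightarrow> 1 / p i \<in> I"
    using strictly_positive_inv_spectrum[OF pos spec] by blast
  define T where "T = (\<Sum>i<d. p i)"
  have tr: "trace_mat \<rho> = complex_of_real T" unfolding \<rho> T_def by (rule trace_spectral_mat[OF U])
  have S: "f_entropy f \<rho> = - (\<Sum>i<d. ?h (p i))"
    unfolding \<rho> by (rule f_entropy_strictly_positive[OF U p(1)])
  have mean: "(\<Sum>i<d. 1 / real d * F i) = (\<Sum>i<d. F i) / real d" for F :: "nat \<Rightarrow> real"
    by (simp add: sum_divide_distrib)
  have le: "real d * ?h (T / real d) \<le> (\<Sum>i<d. ?h (p i))" if d: "d \<noteq> 0"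
  proof -
    have "?h (\<Sum>i<d. 1 / real d * p i) \<le> (\<Sum>i<d. 1 / real d * ?h (p i))"
      using convex_on_sum[OF _ _ perspective_convex[OF cf], of "{..<d}" "\<lambda>_. 1 / real d" p] p d
      by (simp add: lessThan_empty_iff)
    then show ?thesis unfolding mean T_def[symmetric] using d by (simp add: field_simps)
  qed
  have hT: "real d * ?h (T / real d) = T * f (real d / T)" if "d \<noteq> 0"
    using that by simp
  \<comment> \<open>In dimension zero the trace vanishes, so the bound is \<open>0\<close> whatever
    value \<open>f\<close> takes at the quotient of zeros.\<close>
  have d0: "T = 0" if "d = 0" using that unfolding T_def by simp
  show "f_entropy f \<rho> \<le> - Re (trace_mat \<rho>) * f (real d / Re (trace_mat \<rho>))"
  proof (cases "d = 0")
    case True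
    then show ?thesis unfolding S tr using d0 by simp
  next
    case False
    then show ?thesis unfolding S tr using le hT by simp
  qed
  assume strict: "\<And>x y t. x \<in> I \<Longrightarrow> y \<in> I \<Longrightarrow> x \<noteq> y \<Longrightarrow> 0 < t \<Longrightarrow> t < 1 \<Longrightarrow>
        f ((1 - t) * x + t * y) < (1 - t) * f x + t * f y"
  \<comment> \<open>The multiple of the identity is diagonal in the eigenbasis of
    \<open>\<rho>\<close> as well, so equality of the matrices is equality of the
    eigenvalues.\<close>
  have flat: "\<rho> = (trace_mat \<rho> / of_nat d) \<cdot>\<^sub>m 1\<^sub>m d \<longleftrightarrow> (\<forall>i<d. p i = T / real d)"
  proof -
    have id: "(trace_mat \<rho> / of_nat d) \<cdot>\<^sub>m 1\<^sub>m d = spectral_mat d U (\<lambda>_. T / real d)"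
      unfolding spectral_mat_const[OF U] tr by simp
    show ?thesis
      unfolding id unfolding \<rho>
      using spectral_mat_inj[OF U, of p "\<lambda>_. T / real d"]
      by (auto simp: spectral_mat_index[OF unitary_matD(1)[OF U]] intro!: eq_matI
          simp: carrier_matD[OF unitary_matD(1)[OF U]])
  qed
  show "f_entropy f \<rho> = - Re (trace_mat \<rho>) * f (real d / Re (trace_mat \<rho>)) \<longleftrightarrow>
      \<rho> = (trace_mat \<rho> / of_nat d) \<cdot>\<^sub>m 1\<^sub>m d"
  proof (cases "d = 0")
    case True
    then show ?thesis unfolding flat unfolding S tr using d0 by simp
  next
    case False
    show ?thesis unfolding flat
    proof
      assume "f_entropy f \<rho> = - Re (trace_mat \<rho>) * f (real d / Re (trace_mat \<rho>))"
      then have eq: "(\<Sum>i<d. ?h (p i)) = real d * ?h (T / real d)"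
        unfolding S tr hT[OF False] by simp
      show "\<forall>i<d. p i = T / real d"
      proof (intro allI impI)
        fix i assume i: "i < d"
        have "p i = (\<Sum>i<d. 1 / real d * p i)"
        proof (rule strict_jensen_equality[OF perspective_convex[OF cf]])
          show "(\<Sum>i<d. 1 / real d * ?h (p i)) \<le> ?h (\<Sum>i<d. 1 / real d * p i)"
            unfolding mean T_def[symmetric] eq using False by simp
        qed (use i p False perspective_strict[OF strict] in auto)
        then show "p i = T / real d" unfolding mean T_def .
      qed
    next
      assume "\<forall>i<d. p i = T / real d"
      then have "(\<Sum>i<d. ?h (p i)) = real d * ?h (T / real d)" by simp
      then show "f_entropy f \<rho> = - Re (trace_mat \<rho>) * f (real d / Re (trace_mat \<rho>))"
        unfolding S tr hT[OF False] by simp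
    qed
  qed
qed

text \<open>With \<open>n < m\<close> the adjoint of \<open>N\<close> would annihilate some nonzero
  \<open>v\<close>, and the quadratic form of the Gram matrix would vanish at
  \<open>v\<close>.\<close>

lemma strictly_positive_gram_dim:
  assumes N: "N \<in> carrier_mat m n" and pos: "strictly_positive m (N * mat_adjoint N)"
  shows "m \<le> n"
proof (rule ccontr)
  assume "\<not> m \<le> n"
  then have nm: "n < m" by simp
  \<comment> \<open>The determinant criterion for kernel vectors concerns square matrices, so the
    conjugate of \<open>N\<close> is padded with zero columns. Column \<open>n\<close> of
    \<open>Q\<close> is zero, and the transpose of \<open>Q\<close> is the adjoint of
    \<open>N\<close> padded with zero rows.\<close>
  define Q where "Q = mat m m (\<lambda>(i, j). if j < n then cnj (N $$ (i, j)) else 0)"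
  have Q: "Q \<in> carrier_mat m m" unfolding Q_def by simp
  have "Q *\<^sub>v unit_vec m n = 0\<^sub>v m"
    using nm by (intro eq_vecI) (auto simp: Q_def scalar_prod_right_unit[OF nm])
  moreover have "unit_vec m n \<noteq> (0\<^sub>v m :: complex vec)"
    using nm by (metis index_unit_vec(1) index_zero_vec(1) zero_neq_one)
  ultimately have "det Q = 0" using det_0_iff_vec_prod_zero[OF Q] unit_vec_carrier by blast
  then have "det (transpose_mat Q) = 0" by (simp add: det_transpose[OF Q])
  then obtain v where v: "v \<in> carrier_vec m" "v \<noteq> 0\<^sub>v m" and Qv: "transpose_mat Q *\<^sub>v v = 0\<^sub>v m"
    using det_0_iff_vec_prod_zero[OF transpose_carrier_mat[THEN iffD2, OF Q]] by blast
  have Nv: "mat_adjoint N *\<^sub>v v = 0\<^sub>v n"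
  proof (rule eq_vecI)
    fix j assume "j < dim_vec (0\<^sub>v n :: complex vec)"
    then have j: "j < n" by simp
    then have "vec_index (transpose_mat Q *\<^sub>v v) j = 0" unfolding Qv using nm by simp
    moreover have "vec_index (transpose_mat Q *\<^sub>v v) j = vec_index (mat_adjoint N *\<^sub>v v) j"
      using j nm N v Q by (auto simp: scalar_prod_def Q_def intro!: sum.cong)
    ultimately show "vec_index (mat_adjoint N *\<^sub>v v) j = vec_index (0\<^sub>v n) j" using j by simp
  qed (use N in simp)
  have "(N * mat_adjoint N) *\<^sub>v v = N *\<^sub>v (mat_adjoint N *\<^sub>v v)"
    by (rule assoc_mult_mat_vec[OF N mat_adjoint_carrier[OF N] v(1)])
  also have "\<dots> = 0\<^sub>v m" unfolding Nv using N by auto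
  finally have "Re (((N * mat_adjoint N) *\<^sub>v v) \<bullet>c v) = 0" using v(1) by simp
  then show False using pos v unfolding strictly_positive_def by force
qed

text \<open>The polar decomposition \<open>V = N\<^sup>* (N N\<^sup>*)\<^sup>-\<^sup>1\<^sup>/\<^sup>2\<close>, applied to the eigenbasis of \<open>N N\<^sup>*\<close>.\<close>

lemma gram_same_spectrum:
  assumes N: "N \<in> carrier_mat d d" and U: "unitary_mat d U"
    and eq: "N * mat_adjoint N = spectral_mat d U p" and p: "\<And>i. i < d \<Longrightarrow> 0 < p i"
  shows "\<exists>V. unitary_mat d V \<and> mat_adjoint N * N = spectral_mat d V p"
proof -
  note U' = unitary_matD[OF U]
  let ?D = "mat_diag d (\<lambda>i. complex_of_real (1 / sqrt (p i)))"
  have D: "?D \<in> carrier_mat d d" by simp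
  have Da: "mat_adjoint ?D = ?D" by (rule mat_diag_adjoint)
  note c = N U'(1) mat_adjoint_carrier[OF N] mat_adjoint_carrier[OF U'(1)] D
  have DpD: "?D * mat_diag d (\<lambda>i. complex_of_real (p i)) * ?D = 1\<^sub>m d"
  proof -
    have "1 / sqrt (p i) * p i * (1 / sqrt (p i)) = 1" if "i < d" for i
      using p[OF that] by (simp add: field_simps)
    then show ?thesis
      unfolding mat_diag_diag of_real_mult[symmetric] by (intro eq_matI) (auto simp: mat_diag_def)
  qed
  define V where "V = mat_adjoint N * U * ?D"
  have NU: "mat_adjoint N * U \<in> carrier_mat d d" using c by auto
  have V: "V \<in> carrier_mat d d" unfolding V_def using NU D by (rule mult_carrier_mat)
  have Va: "mat_adjoint V = ?D * mat_adjoint U * N"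
    unfolding V_def mat_adjoint_mult[OF NU D] mat_adjoint_mult[OF c(3,2)] Da using c
    by (simp add: assoc_mult_mat[of _ d d _ d _ d] mult_carrier_mat[of _ d d _ d])
  have "mat_adjoint V * V = ?D * (mat_adjoint U * (N * mat_adjoint N) * U) * ?D"
    unfolding Va unfolding V_def using c
    by (simp add: assoc_mult_mat[of _ d d _ d _ d] mult_carrier_mat[of _ d d _ d] del: mat_diag_diag)
  also have "\<dots> = 1\<^sub>m d" unfolding eq spectral_mat_conj[OF U] by (rule DpD)
  finally have VV: "mat_adjoint V * V = 1\<^sub>m d" .
  then have "unitary_mat d V"
    unfolding unitary_mat_def
    using V mat_mult_left_right_inverse[OF mat_adjoint_carrier[OF V] V] by auto
  moreover have "spectral_mat d V p = mat_adjoint N * N"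
  proof -
    have "spectral_mat d V p =
      mat_adjoint N * U * (?D * mat_diag d (\<lambda>i. complex_of_real (p i)) * ?D) * mat_adjoint U * N"
      unfolding spectral_mat_def Va unfolding V_def using c
      by (simp add: assoc_mult_mat[of _ d d _ d _ d] mult_carrier_mat[of _ d d _ d] del: mat_diag_diag)
    also have "\<dots> = mat_adjoint N * (U * mat_adjoint U) * N"
      unfolding DpD using c
      by (simp add: assoc_mult_mat[of _ d d _ d _ d] mult_carrier_mat[of _ d d _ d]
         right_mult_one_mat[of _ d d])
    also have "\<dots> = mat_adjoint N * N" unfolding U'(2) using c by simp
    finally show ?thesis .
  qed
  ultimately show ?thesis by metis
qed

text \<open>Transposition conjugates the eigenvectors and keeps the real eigenvalues.\<close>

lemma transpose_spectral_mat:
  assumes V: "unitary_mat d V"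
  shows "\<exists>W. unitary_mat d W \<and> transpose_mat (spectral_mat d V p) = spectral_mat d W p"
proof (intro exI conjI)
  note V' = unitary_matD[OF V]
  let ?W = "map_mat cnj V"
  have W: "?W \<in> carrier_mat d d" using V' by simp
  show "unitary_mat d ?W"
  proof (rule unitary_colsI[OF W])
    fix i j assume ij: "i < d" "j < d"
    show "(\<Sum>k<d. cnj (?W $$ (k, i)) * ?W $$ (k, j)) = (if i = j then 1 else 0)"
      using unitary_cols[OF V ij(2,1)] ij V'(1) by (auto simp: mult.commute)
  qed
  show "transpose_mat (spectral_mat d V p) = spectral_mat d ?W p"
    using V'(1) by (intro eq_matI)
      (auto simp: spectral_mat_index[OF V'(1)] spectral_mat_index[OF W] mult.commute intro!: sum.cong)
qed

text \<open>\<open>N\<close> is the coefficient matrix of \<open>\<phi>\<close> in the product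
  basis, rows labelled by \<open>A\<close> and columns by \<open>B\<close>; each partial trace is
  the matrix product that sums over the other label.\<close>

lemma f_entropy_partial_traces:
  assumes \<phi>: "\<phi> \<in> carrier_vec (dA * dB)"
    and posA: "strictly_positive dA (partial_trace_B dA dB (ket_bra \<phi>))"
    and posB: "strictly_positive dB (partial_trace_A dA dB (ket_bra \<phi>))"
  shows "f_entropy f (partial_trace_B dA dB (ket_bra \<phi>)) = f_entropy f (partial_trace_A dA dB (ket_bra \<phi>))"
proof -
  define N where "N = mat dA dB (\<lambda>(i, j). vec_index \<phi> (i * dB + j))"
  have N: "N \<in> carrier_mat dA dB" unfolding N_def by simp
  have bound: "i * dB + j < dA * dB" if "i < dA" "j < dB" for i j
  proof -
    have "i * dB + j < Suc i * dB" using that by simp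
    also have "\<dots> \<le> dA * dB" using that by (intro mult_le_mono1) simp
    finally show ?thesis .
  qed
  have kb: "ket_bra \<phi> $$ (i * dB + j, i' * dB + j') = N $$ (i, j) * cnj (N $$ (i', j'))"
    if "i < dA" "j < dB" "i' < dA" "j' < dB" for i j i' j'
    using that bound \<phi> unfolding ket_bra_def N_def by simp
  have A: "partial_trace_B dA dB (ket_bra \<phi>) = N * mat_adjoint N"
  proof (rule eq_matI)
    fix i j assume "i < dim_row (N * mat_adjoint N)" "j < dim_col (N * mat_adjoint N)"
    then have ij: "i < dA" "j < dA" using N by auto
    show "partial_trace_B dA dB (ket_bra \<phi>) $$ (i, j) = (N * mat_adjoint N) $$ (i, j)"
      unfolding mult_mat_index_sum[OF N mat_adjoint_carrier[OF N] ij] using ij N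
      by (auto simp: partial_trace_B_def kb intro!: sum.cong)
  qed (use N in \<open>auto simp: partial_trace_B_def\<close>)
  have B: "partial_trace_A dA dB (ket_bra \<phi>) = transpose_mat (mat_adjoint N * N)"
  proof (rule eq_matI)
    fix i j assume "i < dim_row (transpose_mat (mat_adjoint N * N))" "j < dim_col (transpose_mat (mat_adjoint N * N))"
    then have ij: "i < dB" "j < dB" using N by auto
    have "transpose_mat (mat_adjoint N * N) $$ (i, j) = (mat_adjoint N * N) $$ (j, i)"
      using ij N by simp
    also have "\<dots> = (\<Sum>k<dA. N $$ (k, i) * cnj (N $$ (k, j)))"
      unfolding mult_mat_index_sum[OF mat_adjoint_carrier[OF N] N ij(2,1)] using ij N
      by (auto intro!: sum.cong)
    finally show "partial_trace_A dA dB (ket_bra \<phi>) $$ (i, j) = transpose_mat (mat_adjoint N * N) $$ (i, j)"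
      using ij by (auto simp: partial_trace_A_def kb intro!: sum.cong)
  qed (use N in \<open>auto simp: partial_trace_A_def\<close>)
  \<comment> \<open>Written as the Gram matrix of the transposed coefficients, the second state
    gives the opposite inequality between the dimensions.\<close>
  have B': "partial_trace_A dA dB (ket_bra \<phi>) = transpose_mat N * mat_adjoint (transpose_mat N)"
    unfolding B transpose_mult[OF mat_adjoint_carrier[OF N] N]
    using N by (intro arg_cong[where f = "(*) _"] eq_matI) auto
  have "dA \<le> dB" using strictly_positive_gram_dim[OF N] posA unfolding A by simp
  moreover have "dB \<le> dA"
    using strictly_positive_gram_dim[of "transpose_mat N" dB dA] N posB unfolding B' by simp
  ultimately have d: "dB = dA" by simp
  obtain U p where U: "unitary_mat dA U" and NN: "N * mat_adjoint N = spectral_mat dA U p"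
    and p: "\<And>i. i < dA \<Longrightarrow> 0 < p i"
    using strictly_positive_decomposition[OF posA] unfolding A by blast
  obtain V where V: "unitary_mat dA V" and NV: "mat_adjoint N * N = spectral_mat dA V p"
    using gram_same_spectrum[OF N[unfolded d] U NN p] by blast
  obtain W where W: "unitary_mat dA W" and NW: "transpose_mat (mat_adjoint N * N) = spectral_mat dA W p"
    using transpose_spectral_mat[OF V] unfolding NV by blast
  show ?thesis
    unfolding A B NN NW
    using f_entropy_strictly_positive[OF U, of p f] f_entropy_strictly_positive[OF W, of p f] p by simp
qed

section \<open>Projective measurements\<close>

lemma mat_sum_carrier [simp]: "mat_sum d k F \<in> carrier_mat d d"
  unfolding mat_sum_def by simp

lemma mat_sum_dim [simp]: "dim_row (mat_sum d k F) = d" "dim_col (mat_sum d k F) = d"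
  unfolding mat_sum_def by simp_all

lemma mat_sum_index: "r < d \<Longrightarrow> s < d \<Longrightarrow> mat_sum d k F $$ (r, s) = (\<Sum>i<k. F i $$ (r, s))"
  unfolding mat_sum_def by simp

lemma mat_sum_cong:
  "(\<And>i. i < k \<Longrightarrow> F i = G i) \<Longrightarrow> mat_sum d k F = mat_sum d k G"
  unfolding mat_sum_def by simp

lemma mat_sum_congruence:
  assumes A: "A \<in> carrier_mat d d" and B: "B \<in> carrier_mat d d"
    and F: "\<And>i. i < k \<Longrightarrow> F i \<in> carrier_mat d d"
  shows "A * mat_sum d k F * B = mat_sum d k (\<lambda>i. A * F i * B)"
proof (rule eq_matI)
  fix r s assume "r < dim_row (mat_sum d k (\<lambda>i. A * F i * B))" "s < dim_col (mat_sum d k (\<lambda>i. A * F i * B))"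
  then have rs: "r < d" "s < d" by auto
  have AF: "(A * mat_sum d k F) $$ (r, j) = (\<Sum>i<k. (A * F i) $$ (r, j))" if j: "j < d" for j
  proof -
    have "(A * mat_sum d k F) $$ (r, j) = (\<Sum>l<d. \<Sum>i<k. A $$ (r, l) * F i $$ (l, j))"
      unfolding mult_mat_index_sum[OF A mat_sum_carrier rs(1) j]
      using j by (auto simp: mat_sum_index sum_distrib_left intro!: sum.cong)
    also have "\<dots> = (\<Sum>i<k. (A * F i) $$ (r, j))"
      by (subst sum.swap) (auto simp: mult_mat_index_sum[OF A F rs(1) j] intro!: sum.cong)
    finally show ?thesis .
  qed
  have "(A * mat_sum d k F * B) $$ (r, s) = (\<Sum>j<d. \<Sum>i<k. (A * F i) $$ (r, j) * B $$ (j, s))"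
    unfolding mult_mat_index_sum[OF mult_carrier_mat[OF A mat_sum_carrier] B rs]
    by (intro sum.cong) (auto simp: AF sum_distrib_right simp del: index_mult_mat)
  also have "\<dots> = (\<Sum>i<k. (A * F i * B) $$ (r, s))"
    by (subst sum.swap)
      (intro sum.cong refl, simp add: mult_mat_index_sum[OF mult_carrier_mat[OF A F] B rs] del: index_mult_mat)
  finally show "(A * mat_sum d k F * B) $$ (r, s) = mat_sum d k (\<lambda>i. A * F i * B) $$ (r, s)"
    using rs by (simp add: mat_sum_index)
qed (use A B in auto)

lemma complete_projectorsD:
  assumes "complete_projectors d k P"
  shows "i < k \<Longrightarrow> P i \<in> carrier_mat d d" "i < k \<Longrightarrow> mat_adjoint (P i) = P i"
    "i < k \<Longrightarrow> P i * P i = P i" "mat_sum d k P = 1\<^sub>m d"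
  using assms unfolding complete_projectors_def hermitian_mat_def by auto

lemma measured_spectral_mat:
  assumes P: "complete_projectors d k P" and V: "V \<in> carrier_mat d d"
  shows "measured d k P (spectral_mat d V p) = mat_sum d k (\<lambda>i. spectral_mat d (P i * V) p)"
  unfolding measured_def
proof (rule mat_sum_cong)
  fix i assume i: "i < k"
  show "P i * spectral_mat d V p * P i = spectral_mat d (P i * V) p"
    using spectral_mat_conjugate[OF complete_projectorsD(1)[OF P i] V] complete_projectorsD(2)[OF P i]
    by simp
qed

lemma measured_hermitian:
  assumes P: "complete_projectors d k P" and V: "V \<in> carrier_mat d d"
  shows "hermitian_mat d (measured d k P (spectral_mat d V p))"
proof (rule hermitian_matI)
  fix r s assume rs: "r < d" "s < d"
  have "cnj (spectral_mat d (P i * V) p $$ (r, s)) = spectral_mat d (P i * V) p $$ (s, r)" if "i < k" for i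
    by (rule hermitian_mat_index[OF spectral_mat_hermitian rs])
      (rule mult_carrier_mat[OF complete_projectorsD(1)[OF P that] V])
  then show "cnj (measured d k P (spectral_mat d V p) $$ (r, s)) =
      measured d k P (spectral_mat d V p) $$ (s, r)"
    unfolding measured_spectral_mat[OF P V] using rs by (simp add: mat_sum_index)
qed (simp add: measured_def)

text \<open>Compressing by \<open>P l\<close> and passing to the basis \<open>W\<close> keep the
  spectral form, with \<open>mat_adjoint W * P l * V\<close> as the new matrix of vectors. Each
  diagonal entry is then a nonnegative combination of the \<open>p i\<close>, which is where the
  doubly stochastic weights originate.\<close>

lemma measured_diag:
  assumes P: "complete_projectors d k P" and V: "V \<in> carrier_mat d d" and W: "W \<in> carrier_mat d d"
    and j: "j < d"
  shows "(mat_adjoint W * measured d k P (spectral_mat d V p) * W) $$ (j, j) =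
    complex_of_real (\<Sum>i<d. (\<Sum>l<k. (cmod ((mat_adjoint W * P l * V) $$ (j, i)))\<^sup>2) * p i)"
proof -
  note Wa = mat_adjoint_carrier[OF W] and Pc = complete_projectorsD(1)[OF P]
  have PV: "P l * V \<in> carrier_mat d d" if "l < k" for l using Pc[OF that] V by (rule mult_carrier_mat)
  have "mat_adjoint W * measured d k P (spectral_mat d V p) * W =
      mat_sum d k (\<lambda>l. mat_adjoint W * spectral_mat d (P l * V) p * W)"
    unfolding measured_spectral_mat[OF P V]
    by (rule mat_sum_congruence[OF Wa W]) (rule spectral_mat_carrier[OF PV])
  also have "\<dots> = mat_sum d k (\<lambda>l. spectral_mat d (mat_adjoint W * P l * V) p)"
  proof (rule mat_sum_cong)
    fix l assume l: "l < k"
    show "mat_adjoint W * spectral_mat d (P l * V) p * W = spectral_mat d (mat_adjoint W * P l * V) p"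
      using spectral_mat_conjugate[OF Wa PV[OF l], of p] assoc_mult_mat[OF Wa Pc[OF l] V] by simp
  qed
  finally have *: "mat_adjoint W * measured d k P (spectral_mat d V p) * W =
      mat_sum d k (\<lambda>l. spectral_mat d (mat_adjoint W * P l * V) p)" .
  have "spectral_mat d (mat_adjoint W * P l * V) p $$ (j, j) =
      complex_of_real (\<Sum>i<d. p i * (cmod ((mat_adjoint W * P l * V) $$ (j, i)))\<^sup>2)" if "l < k" for l
    by (rule spectral_mat_diag_index[OF mult_carrier_mat[OF mult_carrier_mat[OF Wa Pc[OF that]] V] j])
  then have "mat_sum d k (\<lambda>l. spectral_mat d (mat_adjoint W * P l * V) p) $$ (j, j) =
      complex_of_real (\<Sum>l<k. \<Sum>i<d. p i * (cmod ((mat_adjoint W * P l * V) $$ (j, i)))\<^sup>2)"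
    using j by (simp add: mat_sum_index del: index_mult_mat)
  also have "(\<Sum>l<k. \<Sum>i<d. p i * (cmod ((mat_adjoint W * P l * V) $$ (j, i)))\<^sup>2) =
      (\<Sum>i<d. (\<Sum>l<k. (cmod ((mat_adjoint W * P l * V) $$ (j, i)))\<^sup>2) * p i)"
    by (subst sum.swap) (simp add: sum_distrib_left mult.commute del: index_mult_mat)
  finally show ?thesis unfolding * .
qed

text \<open>The identity is left unchanged by the measurement, so the diagonal formula with all
  \<open>p i = 1\<close> evaluates the row sum.\<close>

lemma overlap_row_sum:
  assumes P: "complete_projectors d k P" and V: "unitary_mat d V" and W: "unitary_mat d W"
    and j: "j < d"
  shows "(\<Sum>i<d. \<Sum>l<k. (cmod ((mat_adjoint W * P l * V) $$ (j, i)))\<^sup>2) = 1"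
proof -
  note V' = unitary_matD[OF V] and W' = unitary_matD[OF W]
  have one: "spectral_mat d V (\<lambda>_. 1) = 1\<^sub>m d" unfolding spectral_mat_const[OF V] by auto
  have "measured d k P (1\<^sub>m d) = mat_sum d k P"
    unfolding measured_def
  proof (rule mat_sum_cong)
    fix i assume "i < k"
    then show "P i * 1\<^sub>m d * P i = P i"
      using right_mult_one_mat[OF complete_projectorsD(1)[OF P]] complete_projectorsD(3)[OF P] by simp
  qed
  then have "measured d k P (spectral_mat d V (\<lambda>_. 1)) = 1\<^sub>m d"
    unfolding one complete_projectorsD(4)[OF P] .
  then have "(mat_adjoint W * measured d k P (spectral_mat d V (\<lambda>_. 1)) * W) $$ (j, j) = 1"
    using right_mult_one_mat[OF mat_adjoint_carrier[OF W'(1)]] W'(3) j by (simp del: index_mult_mat(1))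
  then show ?thesis
    unfolding measured_diag[OF P V'(1) W'(1) j] by (simp only: of_real_eq_1_iff mult_1_right)
qed

text \<open>As each \<open>P l\<close> is Hermitian, exchanging \<open>V\<close> and
  \<open>W\<close> transposes and conjugates the overlaps, so column sums become row sums.\<close>

lemma overlap_col_sum:
  assumes P: "complete_projectors d k P" and V: "unitary_mat d V" and W: "unitary_mat d W"
    and i: "i < d"
  shows "(\<Sum>j<d. \<Sum>l<k. (cmod ((mat_adjoint W * P l * V) $$ (j, i)))\<^sup>2) = 1"
proof -
  note Vc = unitary_matD(1)[OF V] and Wc = unitary_matD(1)[OF W]
  have "cmod ((mat_adjoint W * P l * V) $$ (j, i)) = cmod ((mat_adjoint V * P l * W) $$ (i, j))"
    if l: "l < k" and j: "j < d" for l j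
  proof -
    note Pc = complete_projectorsD(1)[OF P l]
    note VP = mult_carrier_mat[OF mat_adjoint_carrier[OF Vc] Pc]
    have "mat_adjoint (mat_adjoint V * P l * W) = mat_adjoint W * (P l * V)"
      unfolding mat_adjoint_mult[OF VP Wc] mat_adjoint_mult[OF mat_adjoint_carrier[OF Vc] Pc]
        complete_projectorsD(2)[OF P l] by simp
    also have "\<dots> = mat_adjoint W * P l * V"
      by (rule assoc_mult_mat[OF mat_adjoint_carrier[OF Wc] Pc Vc, symmetric])
    finally have "mat_adjoint W * P l * V = mat_adjoint (mat_adjoint V * P l * W)" ..
    moreover have "mat_adjoint (mat_adjoint V * P l * W) $$ (j, i) = cnj ((mat_adjoint V * P l * W) $$ (i, j))"
      by (rule mat_adjoint_index) (use i j Vc Wc in auto)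
    ultimately show ?thesis by (simp del: index_mult_mat)
  qed
  then have "(\<Sum>j<d. \<Sum>l<k. (cmod ((mat_adjoint W * P l * V) $$ (j, i)))\<^sup>2) =
      (\<Sum>j<d. \<Sum>l<k. (cmod ((mat_adjoint V * P l * W) $$ (i, j)))\<^sup>2)"
    by (intro sum.cong refl) (simp del: index_mult_mat)
  then show ?thesis using overlap_row_sum[OF P W V i] by simp
qed

text \<open>The eigenvalues of \<open>\<Sum>\<^sub>l P\<^sub>l \<rho> P\<^sub>l\<close> are the images of those of \<open>\<rho>\<close> under the doubly
  stochastic matrix \<open>\<Sum>\<^sub>l |W\<^sup>* P\<^sub>l V|\<^sup>2\<close> (squared moduli of the entries).\<close>

lemma f_entropy_measured:
  assumes cf: "convex_on I f" and pos: "strictly_positive d \<rho>" and P: "complete_projectors d k P"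
    and spec: "spectrum_in (mat_inv \<rho>) I"
  shows "f_entropy f \<rho> \<le> f_entropy f (measured d k P \<rho>)"
    and "(\<And>x y t. x \<in> I \<Longrightarrow> y \<in> I \<Longrightarrow> x \<noteq> y \<Longrightarrow> 0 < t \<Longrightarrow> t < 1 \<Longrightarrow>
        f ((1 - t) * x + t * y) < (1 - t) * f x + t * f y) \<Longrightarrow>
      f_entropy f (measured d k P \<rho>) = f_entropy f \<rho> \<Longrightarrow> measured d k P \<rho> = \<rho>"
proof -
  let ?S = "{p. 0 < p \<and> 1 / p \<in> I}" and ?h = "\<lambda>p. p * f (1 / p)"
  obtain V p where V: "unitary_mat d V" and \<rho>: "\<rho> = spectral_mat d V p"
    and p: "\<And>i. i < d \<Longrightarrow> 0 < p i" "\<And>i. i < d \<Longrightarrow> 1 / p i \<in> I"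
    using strictly_positive_inv_spectrum[OF pos spec] by blast
  note Vc = unitary_matD(1)[OF V]
  have pS: "p i \<in> ?S" if "i < d" for i using p that by simp
  obtain W q where W: "unitary_mat d W" and M: "measured d k P \<rho> = spectral_mat d W q"
    using hermitian_spectral_decomposition[OF measured_hermitian[OF P Vc]] \<rho> by blast
  note Wc = unitary_matD(1)[OF W]
  define Y where "Y l = mat_adjoint W * P l * V" for l
  define D where "D j i = (\<Sum>l<k. (cmod (Y l $$ (j, i)))\<^sup>2)" for j i
  have D0: "0 \<le> D j i" for j i unfolding D_def by (intro sum_nonneg) simp
  have row: "(\<Sum>i<d. D j i) = 1" if "j < d" for j
    using overlap_row_sum[OF P V W that] unfolding D_def Y_def .
  have col: "(\<Sum>j<d. D j i) = 1" if "i < d" for i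
    using overlap_col_sum[OF P V W that] unfolding D_def Y_def .
  have q: "q j = (\<Sum>i<d. D j i * p i)" if j: "j < d" for j
  proof -
    have "complex_of_real (q j) = (mat_adjoint W * spectral_mat d W q * W) $$ (j, j)"
      unfolding spectral_mat_conj[OF W] using j by (simp add: mat_diag_def)
    also have "\<dots> = complex_of_real (\<Sum>i<d. D j i * p i)"
      unfolding M[symmetric] \<rho> measured_diag[OF P Vc Wc j] D_def Y_def ..
    finally show ?thesis by (simp only: of_real_eq_iff)
  qed
  have ch: "convex_on ?S ?h" by (rule perspective_convex[OF cf])
  have ne: "{..<d} \<noteq> {}" if "j < d" for j using that by auto
  \<comment> \<open>An average of points of the convex domain of the perspective stays in it; this
    also shows that the \<open>q j\<close> are positive, as the entropy formula requires.\<close>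
  have qS: "q j \<in> ?S" if j: "j < d" for j
    unfolding q[OF j]
    using convex_sum[OF _ convex_on_imp_convex[OF ch] row[OF j], of p] D0 pS by simp
  have jensen: "?h (q j) \<le> (\<Sum>i<d. D j i * ?h (p i))" if j: "j < d" for j
    unfolding q[OF j]
    using convex_on_sum[OF _ ne[OF j] ch row[OF j], of p] D0 pS by simp
  have total: "(\<Sum>j<d. \<Sum>i<d. D j i * ?h (p i)) = (\<Sum>i<d. ?h (p i))"
    by (subst sum.swap) (simp add: sum_distrib_right[symmetric] col)
  have S\<rho>: "f_entropy f \<rho> = - (\<Sum>i<d. ?h (p i))"
    unfolding \<rho> by (rule f_entropy_strictly_positive[OF V p(1)])
  have SM: "f_entropy f (measured d k P \<rho>) = - (\<Sum>j<d. ?h (q j))"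
    unfolding M by (rule f_entropy_strictly_positive[OF W]) (use qS in simp)
  have "(\<Sum>j<d. ?h (q j)) \<le> (\<Sum>j<d. \<Sum>i<d. D j i * ?h (p i))"
    by (intro sum_mono jensen) simp
  then show "f_entropy f \<rho> \<le> f_entropy f (measured d k P \<rho>)"
    unfolding S\<rho> SM total by simp
  assume strict: "\<And>x y t. x \<in> I \<Longrightarrow> y \<in> I \<Longrightarrow> x \<noteq> y \<Longrightarrow> 0 < t \<Longrightarrow> t < 1 \<Longrightarrow>
        f ((1 - t) * x + t * y) < (1 - t) * f x + t * f y"
    and "f_entropy f (measured d k P \<rho>) = f_entropy f \<rho>"
  \<comment> \<open>The Jensen gaps are nonnegative and add up to zero, so each of them is
    zero.\<close>
  then have "(\<Sum>j<d. (\<Sum>i<d. D j i * ?h (p i)) - ?h (q j)) = 0"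
    unfolding S\<rho> SM total[symmetric] sum_subtractf by simp
  then have tight: "(\<Sum>i<d. D j i * ?h (p i)) = ?h (q j)" if "j < d" for j
    using sum_nonneg_eq_0_iff[of "{..<d}" "\<lambda>j. (\<Sum>i<d. D j i * ?h (p i)) - ?h (q j)"] jensen that
    by auto
  have pq: "p i = q j" if j: "j < d" and i: "i < d" and "0 < D j i" for i j
    unfolding q[OF j]
  proof (rule strict_jensen_equality[OF ch])
    show "(\<Sum>i<d. D j i * ?h (p i)) \<le> ?h (\<Sum>i<d. D j i * p i)"
      using tight[OF j] unfolding q[OF j] by simp
  qed (use that D0 row pS perspective_strict[OF strict] in auto)
  have Yc: "Y l \<in> carrier_mat d d" if "l < k" for l
    unfolding Y_def
    by (intro mult_carrier_mat[of _ d d] mat_adjoint_carrier Wc Vc complete_projectorsD(1)[OF P that])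
  \<comment> \<open>A single nonzero entry of some \<open>Y l\<close> already makes the weight
    \<open>D j i\<close> positive, so the relation holds for each \<open>l\<close>
    separately.\<close>
  have Y: "Y l $$ (j, i) * complex_of_real (p i) = complex_of_real (q j) * Y l $$ (j, i)"
    if "l < k" "j < d" "i < d" for l i j
  proof (cases "Y l $$ (j, i) = 0")
    case False
    then have "0 < (cmod (Y l $$ (j, i)))\<^sup>2" by simp
    also have "\<dots> \<le> D j i" unfolding D_def using that(1) by (intro member_le_sum) auto
    finally show ?thesis using pq[OF that(2,3)] by simp
  qed simp
  \<comment> \<open>Completeness of the projectors turns the sum of the \<open>Y l\<close> into the
    full overlap of the two eigenbases, which inherits the intertwining relation. This upgrades
    agreement of eigenvalues to equality of matrices.\<close>
  have WV: "mat_adjoint W * V = mat_sum d k Y"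
  proof -
    have "mat_adjoint W * V = mat_adjoint W * mat_sum d k P * V"
      unfolding complete_projectorsD(4)[OF P] using right_mult_one_mat[OF mat_adjoint_carrier[OF Wc]] by simp
    also have "\<dots> = mat_sum d k Y"
      unfolding Y_def by (rule mat_sum_congruence[OF mat_adjoint_carrier[OF Wc] Vc complete_projectorsD(1)[OF P]])
    finally show ?thesis .
  qed
  have "spectral_mat d V p = spectral_mat d W q"
    unfolding spectral_mat_eq_iff_intertwine[OF V W] WV
    by (auto simp: mat_sum_index sum_distrib_left sum_distrib_right Y intro!: sum.cong)
  then show "measured d k P \<rho> = \<rho>" using M \<rho> by simp
qed

theorem lemma8:
  fixes f :: "real \<Rightarrow> real" and I :: "real set" and \<alpha> :: real
  assumes "operator_convex_on I f"
    and "I \<subseteq> {0<..<\<alpha>}"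
  shows
    "(\<forall>d \<rho>. strictly_positive d \<rho> \<longrightarrow> spectrum_in (mat_inv \<rho>) I \<longrightarrow>
        f_entropy f \<rho> \<le> - Re (trace_mat \<rho>) * f (real d / Re (trace_mat \<rho>)) \<and>
        (non_affine_on I f \<longrightarrow>
           (f_entropy f \<rho> = - Re (trace_mat \<rho>) * f (real d / Re (trace_mat \<rho>)) \<longleftrightarrow>
            \<rho> = (trace_mat \<rho> / of_nat d) \<cdot>\<^sub>m 1\<^sub>m d)))
     \<and>
     (\<forall>dA dB \<phi> \<rho>A \<rho>B. \<phi> \<in> carrier_vec (dA * dB) \<longrightarrow>
        \<rho>A = partial_trace_B dA dB (ket_bra \<phi>) \<longrightarrow>
        \<rho>B = partial_trace_A dA dB (ket_bra \<phi>) \<longrightarrow>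
        strictly_positive dA \<rho>A \<longrightarrow> strictly_positive dB \<rho>B \<longrightarrow>
        spectrum_in (mat_inv \<rho>A) I \<longrightarrow> spectrum_in (mat_inv \<rho>B) I \<longrightarrow>
        f_entropy f \<rho>A = f_entropy f \<rho>B)
     \<and>
     (\<forall>d \<rho> k P. strictly_positive d \<rho> \<longrightarrow> complete_projectors d k P \<longrightarrow>
        spectrum_in (mat_inv \<rho>) I \<longrightarrow> spectrum_in (mat_inv (measured d k P \<rho>)) I \<longrightarrow>
        f_entropy f (measured d k P \<rho>) \<ge> f_entropy f \<rho> \<and>
        (non_affine_on I f \<and> diffused_on I f \<longrightarrow>
           (f_entropy f (measured d k P \<rho>) = f_entropy f \<rho> \<longleftrightarrow> measured d k P \<rho> = \<rho>)))"
proof (intro conjI allI impI)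
  note cf = operator_convex_on_imp_convex_on[OF assms(1)]
    and strict = operator_convex_strict[OF assms(1)]
  {
    fix d \<rho> assume \<rho>: "strictly_positive d \<rho>" "spectrum_in (mat_inv \<rho>) I"
    show "f_entropy f \<rho> \<le> - Re (trace_mat \<rho>) * f (real d / Re (trace_mat \<rho>))"
      by (rule f_entropy_le_maximally_mixed(1)[OF cf \<rho>])
    show "f_entropy f \<rho> = - Re (trace_mat \<rho>) * f (real d / Re (trace_mat \<rho>)) \<longleftrightarrow>
        \<rho> = (trace_mat \<rho> / of_nat d) \<cdot>\<^sub>m 1\<^sub>m d" if "non_affine_on I f"
      by (rule f_entropy_le_maximally_mixed(2)[OF cf \<rho> strict[OF that]])
  next
    fix dA dB \<phi> \<rho>A \<rho>B
    assume "\<phi> \<in> carrier_vec (dA * dB)" "\<rho>A = partial_trace_B dA dB (ket_bra \<phi>)"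
      "\<rho>B = partial_trace_A dA dB (ket_bra \<phi>)" "strictly_positive dA \<rho>A" "strictly_positive dB \<rho>B"
    then show "f_entropy f \<rho>A = f_entropy f \<rho>B" using f_entropy_partial_traces by simp
  next
    fix d \<rho> k P
    assume *: "strictly_positive d \<rho>" "complete_projectors d k P" "spectrum_in (mat_inv \<rho>) I"
    show "f_entropy f (measured d k P \<rho>) \<ge> f_entropy f \<rho>"
      by (rule f_entropy_measured(1)[OF cf *])
    show "f_entropy f (measured d k P \<rho>) = f_entropy f \<rho> \<longleftrightarrow> measured d k P \<rho> = \<rho>"
      if "non_affine_on I f \<and> diffused_on I f"
    proof
      assume "f_entropy f (measured d k P \<rho>) = f_entropy f \<rho>"
      with f_entropy_measured(2)[OF cf * strict] that show "measured d k P \<rho> = \<rho>" by blast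
    qed simp
  }
qed

end
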